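(* Let $X$ be a separable Banach space, $T:X\to X$ a bounded linear operator, $\alpha>1$, and $\omega:\mathbb N\to(1,+\infty)$ with $\omega(k)\to+\infty$. Suppose that for every function $\omega_0:[1,+\infty)\to(1,+\infty)$ tending to infinity, one can find a sequence $\mathcal D=(x_n)_{n\geq1}\subset X$ and maps $S_n:\mathcal D\to X$, $n\geq0$, such that: (i) for every $x\in\mathcal D$, $\sum_{n\geq0}T^nx$ converges unconditionally; (ii) for every $x\in\mathcal D$, $\sum_{n\geq0}S_nx$ converges unconditionally; (iii) for every $x\in\mathcal D$, $T^nS_nx=x$ and $T^mS_nx=S_{n-m}x$ for all $n>m$; (iv) for every $(n_k)_{k\in\mathbb Z}\in\mathbb N^{\mathbb Z}$ such that $\sum_{k\geq0}T^kx_{n_k}$ and $\sum_{k<0}S_{-k}x_{n_k}$ converge, $\left\|\sum_{k\geq0}T^kx_{n_k}\right\|+\left\|\sum_{k<0}S_{-k}x_{n_k}\right\|\leq\sum_{k\in\mathbb Z}\omega_0(n_k)(1+|k|)^{-\alpha}$; (v) the linear span of $\{T^kx_n,S_kx_n:\ k\geq0,n\geq1\}$ is dense in $X$. Then there exists a $T$-invariant Borel probability measure $\mu$ on $X$ with full support, with respect to which $T$ is strongly mixing, such that $E_\omega\subset L^2(X,\mathcal B,\mu)$. Moreover, for every $x^*\in X^*$, the sequence $\frac1{\sqrt n}(x^*+x^*\circ T+\dots+x^*\circ T^{n-1})$ converges in distribution to a Gaussian random variable of finite variance.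
   Context: $E_\omega$ denotes the set of functions $f:X\to\mathbb R$ which are infinitely (Fréchet) differentiable at $0$, satisfy $f(x)=\sum_{\kappa=0}^{\infty}\frac{D^\kappa f(0)}{\kappa!}(x,\dots,x)$ for all $x\in X$, and satisfy $\sup_{\kappa\geq0}\|D^\kappa f(0)\|\,\omega(\kappa)^\kappa<+\infty$. $T$-invariant: $\mu(T^{-1}A)=\mu(A)$; full support: $\mu(U)>0$ for nonempty open $U$; strongly mixing: $\mu(A\cap T^{-n}B)\to\mu(A)\mu(B)$ for Borel $A,B$. *)

theory Defs
  imports "HOL-Probability.Probability"
begin

definition multilinear_form :: "nat \<Rightarrow> ('a::real_normed_vector list \<Rightarrow> real) \<Rightarrow> bool" where
  "multilinear_form k L \<longleftrightarrow>
     (\<forall>i<k. \<forall>us vs. length us = i \<and> length vs = k - Suc i \<longrightarrow> linear (\<lambda>h. L (us @ h # vs))) \<and>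
     (\<exists>C. \<forall>hs. length hs = k \<longrightarrow> \<bar>L hs\<bar> \<le> C * prod_list (map norm hs))"

definition mnorm :: "nat \<Rightarrow> ('a::real_normed_vector list \<Rightarrow> real) \<Rightarrow> real" where
  "mnorm k L = (SUP hs \<in> {hs. length hs = k \<and> (\<forall>h\<in>set hs. norm h \<le> 1)}. \<bar>L hs\<bar>)"

(* D is the family of higher Frechet derivatives of f near x0:
   D 0 = f, and for every k the map y \<mapsto> D k y (valued in the Banach space of
   bounded k-linear forms with norm mnorm k) is Frechet differentiable at every
   point of some neighbourhood of x0, with derivative h \<mapsto> D (Suc k) y (h # _).
   Hence f is infinitely Frechet differentiable at x0 and D k x0 = D^k f(x0). *)
definition higher_frechet_derivs_at ::
    "('a::real_normed_vector \<Rightarrow> real) \<Rightarrow> (nat \<Rightarrow> 'a \<Rightarrow> 'a list \<Rightarrow> real) \<Rightarrow> 'a \<Rightarrow> bool" where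
  "higher_frechet_derivs_at f D x0 \<longleftrightarrow>
     (\<forall>y. D 0 y [] = f y) \<and>
     (\<forall>k. \<exists>e>0. \<forall>y\<in>ball x0 e.
        multilinear_form k (D k y) \<and> multilinear_form (Suc k) (D (Suc k) y) \<and>
        ((\<lambda>h. mnorm k (\<lambda>hs. D k (y + h) hs - D k y hs - D (Suc k) y (h # hs)) / norm h)
            \<longlongrightarrow> 0) (at 0))"

definition E_omega :: "(nat \<Rightarrow> real) \<Rightarrow> ('a::real_normed_vector \<Rightarrow> real) set" where
  "E_omega \<omega> = {f. \<exists>D. higher_frechet_derivs_at f D 0 \<and>
      (\<forall>x. (\<lambda>k. D k 0 (replicate k x) / fact k) sums f x) \<and>
      bdd_above (range (\<lambda>k. mnorm k (D k 0) * \<omega> k ^ k))}"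

end

(* A random vector Y = sum over m, k of xi(m,k) u(m,k) is formed from independent symmetric signs xi(m,k) in {-1,0,1},
   where u(m,.) is the two-sided orbit (T^k x and S_k x) of a rational multiple x of one of the given vectors, so that
   T u(m,k) = u(m,k+1). For fixed m the inner sum converges surely, by unconditional convergence, and it is uniformly
   small outside a finite window of k. The probability p(m) that xi(m,k) is nonzero is chosen after everything else,
   and so small that exp(2 |Y|) is integrable; hence E_omega lies in L^2. Translating k intertwines T with a Bernoulli
   shift, so the law of Y is invariant and strongly mixing, and density of the span yields full support. For a
   functional h, the sum of |h(u(m,k))| over k is finite, so the Birkhoff sums of h(Y) differ from sums of i.i.d.
   variables by an error whose L^1 norm is o(sqrt n), and the classical central limit theorem applies. *)
theory Submission
  imports Defs
begin

text \<open>The obstacle is that unconditional convergence does not bound the sum over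
  \<open>k\<close> of \<open>norm (u m k)\<close>, so the inner sums cannot be estimated term by
  term. Coefficients restricted to -1, 0, 1 avoid this: a signed sum is a difference of two subset
  sums, and subset sums of an unconditionally convergent series are uniformly bounded. The price is
  that the coefficients of a dense span have to be built into the vectors, whence the rational
  multiples. Absolute convergence appears only after a functional is applied, because for scalars
  unconditional convergence is absolute, and the central limit theorem needs no more. The
  probability \<open>p m\<close> meets three demands: division by the window size makes a union
  bound over the window cheap, the exponential factor pays for the exponential moment of all blocks
  up to \<open>m\<close>, and the power of 1/4 is still summable after a square root. The square
  root is forced because the mean absolute value of a sum of n signs is bounded by sqrt (n *
  p).\<close>

section \<open>Mixing of product shifts\<close>

text \<open>The sets with the desired limit form a Dynkin system. Closure under disjoint unions is
  the delicate point: limit and series are exchanged by domination, so \<open>bound\<close> supplies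
  a majorant independent of \<open>n\<close>. The set functions \<open>Q n\<close> are abstract so
  that the lemma can be applied once in each argument of a correlation.\<close>

lemma tendsto_measure_Dynkin:
  fixes Q :: "nat \<Rightarrow> 'a set \<Rightarrow> real"
  assumes M: "prob_space M" and G: "Int_stable G" "G \<subseteq> Pow (space M)" "sets M = sigma_sets (space M) G"
    and sums: "\<And>n C. range C \<subseteq> sets M \<Longrightarrow> disjoint_family C \<Longrightarrow> (\<lambda>i. Q n (C i)) sums Q n (\<Union>i::nat. C i)"
    and bound: "\<And>n C. C \<in> sets M \<Longrightarrow> \<bar>Q n C\<bar> \<le> measure M C"
    and compl: "\<And>n C. C \<in> sets M \<Longrightarrow> Q n (space M - C) = Q n (space M) - Q n C"
    and space: "(\<lambda>n. Q n (space M)) \<longlonglongrightarrow> b"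
    and generator: "\<And>C. C \<in> G \<Longrightarrow> (\<lambda>n. Q n C) \<longlonglongrightarrow> b * measure M C"
    and C: "C \<in> sets M"
  shows "(\<lambda>n. Q n C) \<longlonglongrightarrow> b * measure M C"
proof -
  interpret prob_space M by fact
  from G(1,2) C[unfolded G(3)] show ?thesis
  proof (induction rule: sigma_sets_induct_disjoint)
    case (basic A)
    then show ?case by (rule generator)
  next
    case empty
    have "Q n {} = 0" for n
      using bound[of "{}" n] by simp
    then show ?case by simp
  next
    case (compl A)
    then have A: "A \<in> sets M" by (simp add: G)
    have "(\<lambda>n. Q n (space M) - Q n A) \<longlonglongrightarrow> b - b * measure M A"
      by (intro tendsto_diff space compl)
    then show ?case
      using A by (simp add: assms(7) prob_compl algebra_simps)
  next
    case (union A)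
    then have A: "range A \<subseteq> sets M" by (simp add: G)
    have A': "A i \<in> sets M" for i using A by auto
    have s: "(\<lambda>i. measure M (A i)) sums measure M (\<Union>i. A i)"
      using A union.hyps by (intro finite_measure_UNION) auto
    have "(\<lambda>n. \<Sum>i. Q n (A i)) \<longlonglongrightarrow> (\<Sum>i. b * measure M (A i))"
    proof (rule tannerys_theorem[THEN conjunct2, THEN conjunct2])
      show "summable (\<lambda>i. measure M (A i))" using s by (rule sums_summable)
      show "\<forall>\<^sub>F (k, n) in sequentially \<times>\<^sub>F sequentially. norm (Q n (A k)) \<le> measure M (A k)"
        by (rule always_eventually) (auto simp: bound[OF A'])
    qed (use union.IH in simp_all)
    moreover have "(\<Sum>i. Q n (A i)) = Q n (\<Union>i. A i)" for n
      using sums[OF A] union.hyps by (simp add: sums_iff)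
    moreover have "(\<Sum>i. b * measure M (A i)) = b * measure M (\<Union>i. A i)"
      using s by (simp add: sums_iff suminf_mult)
    ultimately show ?case by simp
  qed
qed

text \<open>Coordinates are read at \<open>k - n\<close>, so that the shift moves coefficients in
  the direction in which \<open>T ^^ n\<close> moves the vectors, from \<open>k\<close> to
  \<open>k + n\<close>.\<close>

definition translate :: "nat \<Rightarrow> ('m \<times> int \<Rightarrow> 'b) \<Rightarrow> 'm \<times> int \<Rightarrow> 'b" where
  "translate n w = (\<lambda>(m, k). w (m, k - int n))"

text \<open>The factor may vary with \<open>m\<close> but not with the integer position, which is
  what makes the product invariant under shifts of the position.\<close>

locale product_shift =
  fixes N :: "'m \<Rightarrow> 'b measure"
  assumes prob_N: "prob_space (N m)" and space_N [simp]: "space (N m) = UNIV"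
begin

sublocale product_prob_space "\<lambda>i :: 'm \<times> int. N (fst i)" UNIV
proof -
  interpret prob_space "N m" for m by (rule prob_N)
  show "product_prob_space (\<lambda>i :: 'm \<times> int. N (fst i))" by unfold_locales
qed

abbreviation W :: "('m \<times> int \<Rightarrow> 'b) measure" where
  "W \<equiv> PiM UNIV (\<lambda>i :: 'm \<times> int. N (fst i))"

lemma space_W [simp]: "space W = UNIV"
  by (simp add: space_PiM)

lemma measure_box:
  assumes "finite J" "\<And>i. i \<in> J \<Longrightarrow> E i \<in> sets (N (fst i))"
  shows "measure W {w. \<forall>i\<in>J. w i \<in> E i} = (\<Prod>i\<in>J. measure (N (fst i)) (E i))"
proof -
  have "prod_emb UNIV (\<lambda>i :: 'm \<times> int. N (fst i)) J (Pi\<^sub>E J E) = {w. \<forall>i\<in>J. w i \<in> E i}"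
    by (auto simp: prod_emb_def space_PiM PiE_def Pi_def)
  then show ?thesis
    using measure_PiM_emb[of J E] assms by simp
qed

lemma measurable_translate [measurable]: "translate n \<in> measurable W W"
proof (rule measurable_PiM_single')
  show "(\<lambda>w. translate n w i) \<in> measurable W (N (fst i))" for i :: "'m \<times> int"
    using measurable_component_singleton[of "(fst i, snd i - int n)" UNIV "\<lambda>i :: 'm \<times> int. N (fst i)"]
    by (simp add: translate_def split_beta)
qed (simp add: PiE_UNIV_domain)

lemma distr_translate: "distr W W (translate n) = W"
proof -
  let ?f = "\<lambda>(m :: 'm, k). (m, k - int n)"
  have "distr W (PiM UNIV (\<lambda>i. N (fst (?f i)))) (\<lambda>w. \<lambda>i\<in>UNIV. w (?f i)) = PiM UNIV (\<lambda>i. N (fst (?f i)))"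
    by (rule distr_PiM_reindex[where M="\<lambda>i :: 'm \<times> int. N (fst i)"]) (auto intro!: inj_onI prob_N)
  moreover have "(\<lambda>w. \<lambda>i\<in>UNIV. w (?f i)) = (translate n :: _ \<Rightarrow> 'm \<times> int \<Rightarrow> 'b)"
    by (auto simp: translate_def fun_eq_iff)
  moreover have "(\<lambda>i. N (fst (?f i))) = (\<lambda>i. N (fst i))"
    by (auto simp: fun_eq_iff)
  ultimately show ?thesis by simp
qed

lemma measure_translate:
  "A \<in> sets W \<Longrightarrow> measure W (translate n -` A) = measure W A"
  using measure_distr[OF measurable_translate, of A n] by (simp add: distr_translate)

lemma translate_vimage_sets: "A \<in> sets W \<Longrightarrow> translate n -` A \<in> sets W"
  using measurable_sets[OF measurable_translate, of A n] by simp

text \<open>Once \<open>n\<close> exceeds twice the largest position occurring in \<open>J\<close>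
  and \<open>K\<close>, the shifted index set no longer meets \<open>J\<close>; independence then
  makes the correlation equal to the product, so the sequence is eventually constant.\<close>

lemma strong_mixing_box:
  assumes J: "finite J" "\<And>i. i \<in> J \<Longrightarrow> E i \<in> sets (N (fst i))"
    and K: "finite K" "\<And>i. i \<in> K \<Longrightarrow> F i \<in> sets (N (fst i))"
  shows "(\<lambda>n. measure W ({w. \<forall>i\<in>J. w i \<in> E i} \<inter> translate n -` {w. \<forall>i\<in>K. w i \<in> F i}))
    \<longlonglongrightarrow> measure W {w. \<forall>i\<in>K. w i \<in> F i} * measure W {w. \<forall>i\<in>J. w i \<in> E i}"
proof -
  let ?f = "\<lambda>n (m :: 'm, k). (m, k - int n)" and ?g = "\<lambda>n (m :: 'm, k). (m, k + int n)"
  let ?A = "{w. \<forall>i\<in>J. w i \<in> E i}" and ?B = "{w. \<forall>i\<in>K. w i \<in> F i}"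
  have gf: "?g n (?f n i) = i" for n i by (auto split: prod.splits)
  have pre: "translate n -` ?B = {w. \<forall>i\<in>?f n ` K. w i \<in> F (?g n i)}" for n
    by (auto simp: translate_def split_beta)
  have Bset: "?B \<in> sets W"
  proof -
    have "prod_emb UNIV (\<lambda>i :: 'm \<times> int. N (fst i)) K (Pi\<^sub>E K F) = ?B"
      by (auto simp: prod_emb_def space_PiM PiE_def Pi_def)
    then show ?thesis
      using sets_PiM_I[of K UNIV F "\<lambda>i :: 'm \<times> int. N (fst i)"] K by simp
  qed
  obtain L where L: "\<And>m k. (m, k) \<in> J \<Longrightarrow> \<bar>k\<bar> \<le> L" "\<And>m k. (m, k) \<in> K \<Longrightarrow> \<bar>k\<bar> \<le> L"
  proof -
    have "finite ((\<lambda>i. \<bar>snd i\<bar>) ` (J \<union> K))" using J K by auto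
    then obtain L where "\<forall>x\<in>(\<lambda>i. \<bar>snd i\<bar>) ` (J \<union> K). x \<le> L"
      using bdd_above_finite[of "(\<lambda>i. \<bar>snd i\<bar>) ` (J \<union> K)"]
      unfolding bdd_above_def by blast
    then show ?thesis by (intro that[of L]) force+
  qed
  have "measure W (?A \<inter> translate n -` ?B) = measure W ?B * measure W ?A" if n: "n > nat (2 * L)" for n
  proof -
    have disj: "J \<inter> ?f n ` K = {}"
    proof (rule ccontr)
      assume "J \<inter> ?f n ` K \<noteq> {}"
      then obtain m k where "(m, k) \<in> K" "(m, k - int n) \<in> J" by auto
      then have "\<bar>k\<bar> \<le> L" "\<bar>k - int n\<bar> \<le> L" using L by auto
      with n show False by linarith
    qed
    let ?E = "\<lambda>i. if i \<in> J then E i else F (?g n i)"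
    have sets: "F (?g n i) \<in> sets (N (fst i))" if "i \<in> ?f n ` K" for i
      using K(2) that by fastforce
    have "?A \<inter> translate n -` ?B = {w. \<forall>i\<in>J \<union> ?f n ` K. w i \<in> ?E i}"
    proof -
      have "(w i \<in> ?E i) = (w i \<in> E i)" if "i \<in> J" for w :: "'m \<times> int \<Rightarrow> 'b" and i using that by simp
      moreover have "(w i \<in> ?E i) = (w i \<in> F (?g n i))" if "i \<in> ?f n ` K" for w :: "'m \<times> int \<Rightarrow> 'b" and i
        using that disj by auto
      ultimately show ?thesis unfolding pre by blast
    qed
    then have "measure W (?A \<inter> translate n -` ?B) = (\<Prod>i\<in>J \<union> ?f n ` K. measure (N (fst i)) (?E i))"
      using J K sets by (simp only:) (rule measure_box, auto)
    also have "\<dots> = (\<Prod>i\<in>J. measure (N (fst i)) (?E i)) * (\<Prod>i\<in>?f n ` K. measure (N (fst i)) (?E i))"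
      using J K disj by (intro prod.union_disjoint) auto
    also have "(\<Prod>i\<in>J. measure (N (fst i)) (?E i)) = measure W ?A"
      using J by (simp add: measure_box)
    also have "(\<Prod>i\<in>?f n ` K. measure (N (fst i)) (?E i)) = (\<Prod>i\<in>?f n ` K. measure (N (fst i)) (F (?g n i)))"
      using disj by (intro prod.cong) auto
    also have "\<dots> = measure W (translate n -` ?B)"
      unfolding pre using K sets by (intro measure_box[symmetric]) auto
    also have "\<dots> = measure W ?B"
      using Bset by (rule measure_translate)
    finally show ?thesis by simp
  qed
  then have "\<forall>\<^sub>F n in sequentially. measure W (?A \<inter> translate n -` ?B) = measure W ?B * measure W ?A"
    by (intro eventually_mono[OF eventually_gt_at_top[of "nat (2 * L)"]])
  then show ?thesis by (rule tendsto_eventually)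
qed

text \<open>Boxes are extended to all measurable sets in two passes of the Dynkin argument: first in
  \<open>A\<close> with a box \<open>B\<close> fixed, then in \<open>B\<close> with \<open>A\<close>
  arbitrary.\<close>

lemma strong_mixing:
  assumes A: "A \<in> sets W" and B: "B \<in> sets W"
  shows "(\<lambda>n. measure W (A \<inter> translate n -` B)) \<longlonglongrightarrow> measure W A * measure W B"
proof -
  let ?G = "prod_algebra UNIV (\<lambda>i :: 'm \<times> int. N (fst i))"
  have G: "Int_stable ?G" "?G \<subseteq> Pow (space W)" "sets W = sigma_sets (space W) ?G"
    by (auto simp: Int_stable_prod_algebra sets_PiM PiE_UNIV_domain)
  have GE: thesis
    if "C \<in> ?G" and "\<And>J E. finite J \<Longrightarrow> (\<And>i. i \<in> J \<Longrightarrow> E i \<in> sets (N (fst i))) \<Longrightarrow>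
      C = {w. \<forall>i\<in>J. w i \<in> E i} \<Longrightarrow> thesis" for C thesis
    using that(1)
  proof (rule prod_algebraE)
    fix J E assume "C = prod_emb UNIV (\<lambda>i :: 'm \<times> int. N (fst i)) J (Pi\<^sub>E J E)" "finite J"
      "\<And>i. i \<in> J \<Longrightarrow> E i \<in> sets (N (fst i))"
    then show thesis
      by (intro that(2)[of J E]) (auto simp: prod_emb_def space_PiM PiE_def Pi_def)
  qed
  have Gsets: "C \<in> sets W" if "C \<in> ?G" for C using that G(3) by auto
  note [simp] = translate_vimage_sets
  have base: "(\<lambda>n. measure W (C \<inter> translate n -` B)) \<longlonglongrightarrow> measure W B * measure W C"
    if B: "B \<in> ?G" and C: "C \<in> sets W" for B C
  proof (rule tendsto_measure_Dynkin[OF _ G _ _ _ _ _ C])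
    note Bs = Gsets[OF B]
    show "prob_space W" by unfold_locales
    show "(\<lambda>n. measure W (space W \<inter> translate n -` B)) \<longlonglongrightarrow> measure W B"
      using Bs by (simp add: measure_translate)
    show "(\<lambda>n. measure W (C \<inter> translate n -` B)) \<longlonglongrightarrow> measure W B * measure W C" if "C \<in> ?G" for C
      using that
    proof (rule GE)
      fix J E assume *: "finite J" "\<And>i. i \<in> J \<Longrightarrow> E i \<in> sets (N (fst i))" "C = {w. \<forall>i\<in>J. w i \<in> E i}"
      from B show ?thesis
      proof (rule GE)
        fix K F assume "finite K" "\<And>i. i \<in> K \<Longrightarrow> F i \<in> sets (N (fst i))" "B = {w. \<forall>i\<in>K. w i \<in> F i}"
        then show ?thesis
          using strong_mixing_box[of J E K F] * by metis
      qed
    qed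
    show "\<bar>measure W (C \<inter> translate n -` B)\<bar> \<le> measure W C" if "C \<in> sets W" for C n
      using that by (auto intro!: finite_measure_mono)
    show "measure W ((space W - C) \<inter> translate n -` B)
      = measure W (space W \<inter> translate n -` B) - measure W (C \<inter> translate n -` B)" if "C \<in> sets W" for C n
    proof -
      have "(space W - C) \<inter> translate n -` B = translate n -` B - C \<inter> translate n -` B" by auto
      then show ?thesis
        using that Bs by (simp add: finite_measure_Diff)
    qed
    show "(\<lambda>i. measure W (C i \<inter> translate n -` B)) sums measure W ((\<Union>i. C i) \<inter> translate n -` B)"
      if "range C \<subseteq> sets W" "disjoint_family C" for C :: "nat \<Rightarrow> _" and n
    proof -
      have "(\<lambda>i. measure W (C i \<inter> translate n -` B)) sums measure W (\<Union>i. C i \<inter> translate n -` B)"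
        using that Bs by (intro finite_measure_UNION) (auto simp: disjoint_family_on_def)
      then show ?thesis by simp
    qed
  qed
  have "(\<lambda>n. measure W (A \<inter> translate n -` B)) \<longlonglongrightarrow> measure W A * measure W B"
  proof (rule tendsto_measure_Dynkin[OF _ G _ _ _ _ _ B])
    show "prob_space W" by unfold_locales
    show "(\<lambda>n. measure W (A \<inter> translate n -` space W)) \<longlonglongrightarrow> measure W A" by simp
    show "(\<lambda>n. measure W (A \<inter> translate n -` C)) \<longlonglongrightarrow> measure W A * measure W C" if "C \<in> ?G" for C
      using base[OF that A] by (simp add: mult.commute)
    show "\<bar>measure W (A \<inter> translate n -` C)\<bar> \<le> measure W C" if "C \<in> sets W" for C n
    proof -
      \<comment> \<open>In the second argument the domination by \<open>measure W C\<close> comes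
        from invariance of \<open>W\<close> under the shift.\<close>
      have "measure W (A \<inter> translate n -` C) \<le> measure W (translate n -` C)"
        using that by (auto intro!: finite_measure_mono)
      then show ?thesis using that by (simp add: measure_translate)
    qed
    show "measure W (A \<inter> translate n -` (space W - C))
      = measure W (A \<inter> translate n -` space W) - measure W (A \<inter> translate n -` C)" if "C \<in> sets W" for C n
    proof -
      have "A \<inter> translate n -` (space W - C) = A - A \<inter> translate n -` C" by auto
      then show ?thesis
        using that A by (simp add: finite_measure_Diff)
    qed
    show "(\<lambda>i. measure W (A \<inter> translate n -` C i)) sums measure W (A \<inter> translate n -` (\<Union>i. C i))"
      if "range C \<subseteq> sets W" "disjoint_family C" for C :: "nat \<Rightarrow> _" and n
    proof -
      have "(\<lambda>i. measure W (A \<inter> translate n -` C i)) sums measure W (\<Union>i. A \<inter> translate n -` C i)"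
        using that A by (intro finite_measure_UNION) (auto simp: disjoint_family_on_def)
      moreover have "(\<Union>i. A \<inter> translate n -` C i) = A \<inter> translate n -` (\<Union>i. C i)" by auto
      ultimately show ?thesis by simp
    qed
  qed
  then show ?thesis .
qed

end

section \<open>Random series of two-sided orbits\<close>

text \<open>If \<open>K\<close> is the last index with \<open>x \<in> A K\<close>, the random sum is
  at most the deterministic sum up to \<open>K\<close>, so its exponential is dominated by the
  single term \<open>g K x\<close>, hence by 1 plus the series of all \<open>g n\<close>.
  Borel-Cantelli makes \<open>K\<close> finite almost surely, and the 1 covers points that lie in no
  \<open>A n\<close>.\<close>

lemma (in prob_space) exp_sum_indicator:
  fixes c :: "nat \<Rightarrow> real"
  assumes A [measurable]: "\<And>n. A n \<in> sets M" and c: "\<And>n. c n \<ge> 0"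
    and summable: "summable (\<lambda>n. prob (A n) * exp (\<Sum>j\<le>n. c j))"
  shows "AE x in M. eventually (\<lambda>n. x \<notin> A n) sequentially"
    and "integrable M (\<lambda>x. exp (\<Sum>n. c n * indicator (A n) x))"
proof -
  have "prob (A n) \<le> prob (A n) * exp (\<Sum>j\<le>n. c j)" for n
    using mult_left_mono[of 1 "exp (\<Sum>j\<le>n. c j)" "prob (A n)"] c by (simp add: sum_nonneg)
  then have "summable (\<lambda>n. prob (A n))"
    by (intro summable_comparison_test'[OF summable, of 0]) auto
  then have "AE x in M. eventually (\<lambda>n. x \<in> space M - A n) sequentially"
    by (intro borel_cantelli_AE1) (auto simp: emeasure_eq_measure)
  then show ev: "AE x in M. eventually (\<lambda>n. x \<notin> A n) sequentially"
  proof eventually_elim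
    case (elim x)
    then show ?case by (rule eventually_mono) simp
  qed
  define g where "g n x = indicator (A n) x * exp (\<Sum>j\<le>n. c j)" for n x
  have finite_sum: "summable (\<lambda>n. indicator (A n) x * h n :: real)"
    if "eventually (\<lambda>n. x \<notin> A n) sequentially" for x h
  proof -
    from that have "eventually (\<lambda>n. norm (indicator (A n) x * h n :: real) \<le> 0) sequentially"
      by eventually_elim auto
    then show ?thesis by (rule summable_comparison_test_ev[OF _ summable_zero])
  qed
  have int: "integrable M (\<lambda>x. \<Sum>n. g n x)"
  proof (rule integrable_suminf)
    show "integrable M (g n)" for n
      unfolding g_def by (intro integrable_mult_left integrable_real_indicator) (auto simp: emeasure_eq_measure)
    show "AE x in M. summable (\<lambda>n. norm (g n x))"
      using ev by eventually_elim (simp add: g_def abs_mult finite_sum)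
    have "(\<integral>x. norm (g n x) \<partial>M) = prob (A n) * exp (\<Sum>j\<le>n. c j)" for n
      by (simp add: g_def abs_mult)
    then show "summable (\<lambda>n. \<integral>x. norm (g n x) \<partial>M)" using summable by simp
  qed
  have bound: "exp (\<Sum>n. c n * indicator (A n) x) \<le> 1 + (\<Sum>n. g n x)"
    if x: "eventually (\<lambda>n. x \<notin> A n) sequentially" for x
  proof (cases "\<exists>n. x \<in> A n")
    case True
    obtain B where "\<forall>n\<ge>B. x \<notin> A n"
      using x unfolding eventually_sequentially by blast
    then have B: "n \<le> B" if "x \<in> A n" for n
      using that \<open>\<forall>n\<ge>B. x \<notin> A n\<close> by (cases "B \<le> n") auto
    define K where "K = (GREATEST n. x \<in> A n)"
    have K: "x \<in> A K"
      unfolding K_def by (rule GreatestI_ex_nat[OF True B])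
    have K_ge: "n \<le> K" if "x \<in> A n" for n
      unfolding K_def by (rule Greatest_le_nat[where P="\<lambda>n. x \<in> A n" and b=B, OF that B])
    have "(\<Sum>n. c n * indicator (A n) x) = (\<Sum>n\<le>K. c n * indicator (A n) x)"
      using K_ge by (intro suminf_finite) (auto simp: indicator_def)
    also have "\<dots> \<le> (\<Sum>n\<le>K. c n)"
      using c by (intro sum_mono) (auto simp: indicator_def)
    finally have "exp (\<Sum>n. c n * indicator (A n) x) \<le> g K x"
      using K by (simp add: g_def)
    also have "g K x \<le> (\<Sum>n. g n x)"
    proof -
      have "(\<Sum>n\<in>{K}. g n x) \<le> (\<Sum>n. g n x)"
        by (rule sum_le_suminf) (auto simp: g_def finite_sum[OF x])
      then show ?thesis by simp
    qed
    finally show ?thesis by simp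
  next
    case False
    then show ?thesis by (simp add: g_def)
  qed
  show "integrable M (\<lambda>x. exp (\<Sum>n. c n * indicator (A n) x))"
  proof (rule Bochner_Integration.integrable_bound)
    show "integrable M (\<lambda>x. 1 + (\<Sum>n. g n x))"
      using int by simp
    show "AE x in M. norm (exp (\<Sum>n. c n * indicator (A n) x)) \<le> norm (1 + (\<Sum>n. g n x))"
      using ev
  proof eventually_elim
    case (elim x)
    show ?case
      unfolding real_norm_def abs_exp_cancel by (rule order_trans[OF bound[OF elim] abs_ge_self])
  qed
  qed simp
qed

text \<open>The first bit decides whether the variable is nonzero, the second is a fair sign. Two
  independent bits reduce every expectation to a sum over four outcomes.\<close>

definition coin :: "real \<Rightarrow> (bool \<times> bool) pmf" where
  "coin q = pair_pmf (bernoulli_pmf q) (bernoulli_pmf (1/2))"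

definition coin_sign :: "bool \<times> bool \<Rightarrow> real" where
  "coin_sign b = (if fst b then if snd b then 1 else - 1 else 0)"

lemma integral_coin:
  assumes "0 \<le> q" "q \<le> 1"
  shows "measure_pmf.expectation (coin q) (g :: _ \<Rightarrow> real) =
    q / 2 * (g (True, True) + g (True, False)) + (1 - q) / 2 * (g (False, True) + g (False, False))"
proof -
  have U: "(UNIV :: (bool \<times> bool) set) = {(True, True), (True, False), (False, True), (False, False)}"
    by auto
  have "measure_pmf.expectation (coin q) g = (\<Sum>b\<in>UNIV. g b * pmf (coin q) b)"
    by (rule integral_measure_pmf_real) auto
  also have "\<dots> = q / 2 * (g (True, True) + g (True, False)) + (1 - q) / 2 * (g (False, True) + g (False, False))"
    unfolding U using assms by (simp add: coin_def pmf_pair field_simps)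
  finally show ?thesis .
qed

section \<open>Independent sparse signs over a two-sided index set\<close>

locale coin_shift =
  fixes p :: "'m \<Rightarrow> real"
  assumes p_pos: "0 < p m" and p_le_1: "p m \<le> 1"
begin

sublocale product_shift "\<lambda>m. measure_pmf (coin (p m))"
  by unfold_locales (auto simp: measure_pmf.prob_space_axioms)

definition xi :: "'m \<times> int \<Rightarrow> ('m \<times> int \<Rightarrow> bool \<times> bool) \<Rightarrow> real" where
  "xi i w = coin_sign (w i)"

lemma xi_range: "xi i w \<in> {-1, 0, 1}"
  by (auto simp: xi_def coin_sign_def)

lemma abs_xi_le: "\<bar>xi i w\<bar> \<le> 1"
  using xi_range[of i w] by auto

lemma xi_translate: "xi (m, k) (translate n w) = xi (m, k - int n) w"
  by (simp add: xi_def translate_def)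

lemma measurable_coordinate:
  "(\<lambda>w. w i) \<in> measurable W (measure_pmf (coin (p (fst i))))"
  using measurable_component_singleton[of i UNIV "\<lambda>i. measure_pmf (coin (p (fst i)))"] by simp

lemma measurable_xi [measurable]: "xi i \<in> borel_measurable W"
  unfolding xi_def [abs_def]
  by (rule measurable_compose[OF measurable_coordinate]) simp

lemma integral_coordinate:
  fixes g :: "bool \<times> bool \<Rightarrow> real"
  shows "(\<integral>w. g (w i) \<partial>W) = measure_pmf.expectation (coin (p (fst i))) g"
proof -
  have "measure_pmf.expectation (coin (p (fst i))) g
    = integral\<^sup>L (distr W (measure_pmf (coin (p (fst i)))) (\<lambda>w. w i)) g"
    by (simp add: PiM_component)
  also have "\<dots> = (\<integral>w. g (w i) \<partial>W)"
    by (intro integral_distr measurable_coordinate) simp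
  finally show ?thesis ..
qed

lemma expectation_xi: "(\<integral>w. xi i w \<partial>W) = 0"
  and expectation_abs_xi: "(\<integral>w. \<bar>xi i w\<bar> \<partial>W) = p (fst i)"
  and expectation_xi_square: "(\<integral>w. (xi i w)\<^sup>2 \<partial>W) = p (fst i)"
  unfolding xi_def integral_coordinate[of "\<lambda>b. coin_sign b"] integral_coordinate[of "\<lambda>b. \<bar>coin_sign b\<bar>"]
    integral_coordinate[of "\<lambda>b. (coin_sign b)\<^sup>2"]
    integral_coin[OF less_imp_le[OF p_pos] p_le_1]
  by (simp_all add: coin_sign_def)

lemma integrable_xi: "integrable W (xi i)"
  by (rule integrable_const_bound[of _ 1]) (auto simp: abs_xi_le)

lemma xi_nonzero_sets [measurable, simp]: "{w. xi i w \<noteq> 0} \<in> sets W"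
proof -
  have "{w \<in> space W. xi i w \<noteq> 0} \<in> sets W" by measurable
  then show ?thesis by simp
qed

lemma prob_xi_nonzero: "P.prob {w. xi i w \<noteq> 0} = p (fst i)"
proof -
  have "P.prob {w. xi i w \<noteq> 0} = (\<integral>w. indicator {w. xi i w \<noteq> 0} w \<partial>W)"
    by simp
  also have "\<dots> = (\<integral>w. \<bar>xi i w\<bar> \<partial>W)"
  proof (rule Bochner_Integration.integral_cong[OF refl])
    show "indicator {w. xi i w \<noteq> 0} w = \<bar>xi i w\<bar>" for w
      using xi_range[of i w] by auto
  qed
  finally show ?thesis by (simp add: expectation_abs_xi)
qed

lemma indep_coordinates:
  "P.indep_vars (\<lambda>i. measure_pmf (coin (p (fst i)))) (\<lambda>i w. w i) (UNIV :: ('m \<times> int) set)"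
proof (subst P.indep_vars_iff_distr_eq_PiM)
  show "distr W W (\<lambda>x. \<lambda>i\<in>UNIV. x i) =
    PiM UNIV (\<lambda>i. distr W (measure_pmf (coin (p (fst i)))) (\<lambda>w. w i))"
    using distr_id2[of W W] by (simp add: PiM_component restrict_UNIV)
qed (auto simp: measurable_coordinate)

lemma indep_xi: "P.indep_vars (\<lambda>_. borel) xi (UNIV :: ('m \<times> int) set)"
  unfolding xi_def [abs_def]
  by (rule P.indep_vars_compose2[OF indep_coordinates]) simp

lemma expectation_xi_mult:
  assumes "i \<noteq> j"
  shows "(\<integral>w. xi i w * xi j w \<partial>W) = 0"
proof -
  have "(\<integral>w. (\<Prod>l\<in>{i, j}. xi l w) \<partial>W) = (\<Prod>l\<in>{i, j}. \<integral>w. xi l w \<partial>W)"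
    by (rule P.indep_vars_lebesgue_integral)
      (auto intro: P.indep_vars_subset[OF indep_xi] integrable_xi)
  then show ?thesis using assms by (simp add: expectation_xi)
qed

lemma expectation_sum_xi_square:
  assumes "finite J"
  shows "(\<integral>w. (\<Sum>i\<in>J. xi i w)\<^sup>2 \<partial>W) = (\<Sum>i\<in>J. p (fst i))"
proof -
  have int: "integrable W (\<lambda>w. xi i w * xi j w)" for i j
    by (rule integrable_const_bound[of _ 1])
      (auto simp: abs_mult intro!: mult_le_one abs_xi_le)
  have "(\<integral>w. (\<Sum>i\<in>J. xi i w)\<^sup>2 \<partial>W) = (\<Sum>i\<in>J. \<Sum>j\<in>J. \<integral>w. xi i w * xi j w \<partial>W)"
    by (simp add: power2_eq_square sum_product int)
  also have "\<dots> = (\<Sum>i\<in>J. \<Sum>j\<in>J. if i = j then p (fst i) else 0)"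
    by (intro sum.cong refl)
      (auto simp: expectation_xi_mult expectation_xi_square[unfolded power2_eq_square])
  also have "\<dots> = (\<Sum>i\<in>J. p (fst i))"
    using assms by simp
  finally show ?thesis .
qed

text \<open>Cauchy-Schwarz, read off from the nonnegativity of the variance of the absolute value.
  Combined with orthogonality of the signs it yields the growth of order sqrt n in the error
  estimate for Birkhoff sums.\<close>

lemma expectation_abs_sum_xi_le:
  assumes "finite J"
  shows "(\<integral>w. \<bar>\<Sum>i\<in>J. xi i w\<bar> \<partial>W) \<le> sqrt (\<Sum>i\<in>J. p (fst i))"
proof -
  let ?S = "\<lambda>w. \<bar>\<Sum>i\<in>J. xi i w\<bar>"
  have le: "?S w \<le> card J" for w
    using sum_mono[of J "\<lambda>i. \<bar>xi i w\<bar>" "\<lambda>_. 1"]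
    by (intro order_trans[OF sum_abs]) (simp add: abs_xi_le)
  have int: "integrable W ?S"
    by (rule integrable_const_bound[of _ "card J"]) (auto simp: le)
  have int2: "integrable W (\<lambda>w. (?S w)\<^sup>2)"
    by (rule integrable_const_bound[of _ "(card J)\<^sup>2"]) (use le in \<open>auto simp: abs_le_square_iff[symmetric]\<close>)
  have "0 \<le> P.variance ?S" by (rule P.variance_positive)
  also have "P.variance ?S = (\<Sum>i\<in>J. p (fst i)) - (\<integral>w. ?S w \<partial>W)\<^sup>2"
    using int int2 by (subst P.variance_eq) (simp_all add: expectation_sum_xi_square assms)
  finally show ?thesis
    by (intro real_le_rsqrt) simp
qed

end

section \<open>Unconditionally convergent series with signs\<close>

lemma summable_on_tail:
  fixes f :: "'i \<Rightarrow> 'a::banach"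
  assumes f: "f summable_on UNIV" and e: "e > 0"
  obtains F where "finite F" "\<And>A. A \<inter> F = {} \<Longrightarrow> norm (infsum f A) \<le> e"
proof -
  have "(sum f \<longlongrightarrow> infsum f UNIV) (finite_subsets_at_top UNIV)"
    using has_sum_infsum[OF f] by (simp add: has_sum_def)
  then have "\<forall>\<^sub>F A in finite_subsets_at_top UNIV. dist (sum f A) (infsum f UNIV) < e / 2"
    using e by (intro tendstoD) auto
  then obtain F where F: "finite F"
    "\<And>A. finite A \<Longrightarrow> F \<subseteq> A \<Longrightarrow> dist (sum f A) (infsum f UNIV) < e / 2"
    unfolding eventually_finite_subsets_at_top by auto
  \<comment> \<open>The sum over a finite set off \<open>F\<close> is a difference of two partial
    sums that both contain \<open>F\<close>. Infinite sets follow by passing to the limit, so the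
    bound is uniform over all sets missing \<open>F\<close>.\<close>
  have fin: "norm (sum f H) \<le> e" if "finite H" "H \<inter> F = {}" for H
  proof -
    have "sum f H = sum f (F \<union> H) - sum f F"
      using that F(1) by (subst sum.union_disjoint) auto
    also have "norm \<dots> \<le> dist (sum f (F \<union> H)) (infsum f UNIV) + dist (sum f F) (infsum f UNIV)"
      unfolding dist_norm[symmetric] by (rule dist_triangle2)
    finally show ?thesis
      using F(2)[of "F \<union> H"] F(2)[of F] F(1) that by auto
  qed
  show thesis
  proof (rule that[OF F(1)])
    fix A assume A: "A \<inter> F = {}"
    have "f summable_on A" by (rule summable_on_subset_banach[OF f]) simp
    then have "(sum f \<longlongrightarrow> infsum f A) (finite_subsets_at_top A)"
      using has_sum_infsum by (auto simp: has_sum_def)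
    then have "((\<lambda>H. norm (sum f H)) \<longlongrightarrow> norm (infsum f A)) (finite_subsets_at_top A)"
      by (rule tendsto_norm)
    then show "norm (infsum f A) \<le> e"
      by (rule tendsto_upperbound)
        (use A fin in \<open>auto intro!: eventually_finite_subsets_at_top_weakI\<close>)
  qed
qed

text \<open>The index set splits by the sign of the coefficient, and in a Banach space every
  subseries of an unconditionally convergent series converges.\<close>

lemma has_sum_signed:
  fixes f :: "'i \<Rightarrow> 'a::banach" and e :: "'i \<Rightarrow> real"
  assumes f: "f summable_on UNIV" and e: "\<And>k. e k \<in> {-1, 0, 1}"
  shows "((\<lambda>k. e k *\<^sub>R f k) has_sum (infsum f {k. e k = 1} - infsum f {k. e k = -1})) UNIV"
proof -
  have part: "((\<lambda>k. if k \<in> A then f k else 0) has_sum infsum f A) UNIV" for A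
  proof -
    have "(f has_sum infsum f A) A"
      using summable_on_subset_banach[OF f, of A] by simp
    then show ?thesis
      by (subst has_sum_cong_neutral[where g=f and T=A]) auto
  qed
  have "((\<lambda>k. (if k \<in> {k. e k = 1} then f k else 0) + - (if k \<in> {k. e k = -1} then f k else 0))
      has_sum (infsum f {k. e k = 1} + - infsum f {k. e k = -1})) UNIV"
    by (intro has_sum_add part) (simp only: has_sum_uminus minus_minus part)
  also have "(\<lambda>k. (if k \<in> {k. e k = 1} then f k else 0) + - (if k \<in> {k. e k = -1} then f k else 0))
      = (\<lambda>k. e k *\<^sub>R f k)"
  proof
    show "(if k \<in> {k. e k = 1} then f k else 0) + - (if k \<in> {k. e k = -1} then f k else 0) = e k *\<^sub>R f k" for k
      using e[of k] by auto
  qed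
  finally show ?thesis by simp
qed

section \<open>The random vector and its exponential moment\<close>

locale random_series =
  fixes u :: "nat \<Rightarrow> int \<Rightarrow> 'a::{banach, second_countable_topology}" and F :: "nat \<Rightarrow> int set"
  assumes u_summable: "u m summable_on UNIV"
    and finite_F [simp]: "finite (F m)"
    and u_tail: "A \<inter> F m = {} \<Longrightarrow> norm (infsum (u m) A) \<le> (1/2) ^ m"
begin

text \<open>A bound for every signed sum of block \<open>m\<close>: window plus tail controls one
  subset sum, and the factor 2 accounts for positive and negative coefficients.\<close>

definition D :: "nat \<Rightarrow> real" where
  "D m = 2 * ((\<Sum>k\<in>F m. norm (u m k)) + (1/2) ^ m)"

text \<open>The 2 in the exponent is the 2 of the moment \<open>exp (2 * norm (Y w))\<close>, and
  \<open>1 + card (F m)\<close> keeps the denominator positive for an empty window.\<close>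

definition p :: "nat \<Rightarrow> real" where
  "p m = exp (- 2 * (\<Sum>n\<le>m. D n)) * (1/4) ^ Suc m / (1 + card (F m))"

lemma D_nonneg: "D m \<ge> 0"
  by (auto simp: D_def intro!: add_nonneg_nonneg sum_nonneg)

lemma card_p: "(1 + card (F m)) * p m = exp (- 2 * (\<Sum>n\<le>m. D n)) * (1/4) ^ Suc m"
proof -
  have "real (1 + n) * (b / real (1 + n)) = b" for n and b :: real by simp
  then show ?thesis unfolding p_def by blast
qed

lemma p_le: "p m \<le> exp (- 2 * (\<Sum>n\<le>m. D n)) * (1/4) ^ Suc m"
  unfolding p_def by (simp add: divide_le_eq mult_le_cancel_left1)

sublocale coin_shift p
proof
  show "0 < p m" for m unfolding p_def by (intro divide_pos_pos mult_pos_pos) simp_all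
  have "exp (- 2 * (\<Sum>n\<le>m. D n)) * (1/4) ^ Suc m \<le> 1 * 1" for m
    by (intro mult_mono power_le_one) (auto intro!: sum_nonneg D_nonneg)
  then show "p m \<le> 1" for m using order_trans[OF p_le[of m]] by simp
qed

lemma norm_infsum_subset: "norm (infsum (u m) A) \<le> (\<Sum>k\<in>F m. norm (u m k)) + (1/2) ^ m"
proof -
  have s: "u m summable_on B" for B by (rule summable_on_subset_banach[OF u_summable]) simp
  have "infsum (u m) ((A \<inter> F m) \<union> (A - F m)) = infsum (u m) (A \<inter> F m) + infsum (u m) (A - F m)"
    by (intro infsum_Un_disjoint s) auto
  moreover have "(A \<inter> F m) \<union> (A - F m) = A" by auto
  moreover have "norm (infsum (u m) (A \<inter> F m)) \<le> (\<Sum>k\<in>A \<inter> F m. norm (u m k))"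
    by (simp add: norm_sum)
  moreover have "\<dots> \<le> (\<Sum>k\<in>F m. norm (u m k))"
    by (intro sum_mono2) auto
  moreover have "norm (infsum (u m) (A - F m)) \<le> (1/2) ^ m"
    by (rule u_tail) auto
  ultimately show ?thesis
    using norm_triangle_ineq[of "infsum (u m) (A \<inter> F m)" "infsum (u m) (A - F m)"] by simp
qed

lemma norm_signed_le: "(\<And>k. e k \<in> {-1, 0, 1}) \<Longrightarrow> norm (\<Sum>\<^sub>\<infinity>k. e k *\<^sub>R u m k) \<le> D m"
  using norm_triangle_ineq4[of "infsum (u m) {k. e k = 1}" "infsum (u m) {k. e k = -1}"]
    norm_infsum_subset[of m "{k. e k = 1}"] norm_infsum_subset[of m "{k. e k = -1}"]
  by (simp add: infsumI[OF has_sum_signed[OF u_summable]] D_def)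

text \<open>The finite set and the error are left general because full support needs finer windows
  than \<open>F m\<close>.\<close>

lemma norm_signed_small:
  assumes e: "\<And>k. e k \<in> {-1, 0, 1}" and small: "\<And>A. A \<inter> G = {} \<Longrightarrow> norm (infsum (u m) A) \<le> \<epsilon>"
    and zero: "\<And>k. k \<in> G \<Longrightarrow> e k = 0"
  shows "norm (\<Sum>\<^sub>\<infinity>k. e k *\<^sub>R u m k) \<le> 2 * \<epsilon>"
proof -
  have "norm (infsum (u m) {k. e k = 1}) \<le> \<epsilon>" "norm (infsum (u m) {k. e k = -1}) \<le> \<epsilon>"
    using zero by (auto intro!: small)
  then show ?thesis
    using norm_triangle_ineq4[of "infsum (u m) {k. e k = 1}" "infsum (u m) {k. e k = -1}"]
    by (simp add: infsumI[OF has_sum_signed[OF u_summable e]])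
qed

definition X :: "nat \<Rightarrow> (nat \<times> int \<Rightarrow> bool \<times> bool) \<Rightarrow> 'a" where
  "X m w = (\<Sum>\<^sub>\<infinity>k. xi (m, k) w *\<^sub>R u m k)"

text \<open>Each \<open>X m\<close> converges surely, but convergence of this outer series is known
  only where finitely many windows are active, hence almost surely. Pointwise statements about
  \<open>Y\<close> carry that hypothesis.\<close>

definition Y :: "(nat \<times> int \<Rightarrow> bool \<times> bool) \<Rightarrow> 'a" where
  "Y w = (\<Sum>m. X m w)"

text \<open>Only finitely many coordinates enter this event, yet off it \<open>X m\<close> is small
  whatever the signs outside the window are. Borel-Cantelli on these events therefore controls the
  whole series.\<close>

definition active :: "nat \<Rightarrow> (nat \<times> int \<Rightarrow> bool \<times> bool) set" where
  "active m = {w. \<exists>k\<in>F m. xi (m, k) w \<noteq> 0}"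

lemma X_has_sum: "((\<lambda>k. xi (m, k) w *\<^sub>R u m k) has_sum X m w) UNIV"
  unfolding X_def by (rule has_sum_infsum) (rule has_sum_imp_summable[OF has_sum_signed[OF u_summable xi_range]])

lemma measurable_X [measurable]: "X m \<in> borel_measurable W"
proof -
  \<comment> \<open>An enumeration of the integers turns the unordered sum into a pointwise limit of
    partial sums.\<close>
  have "X m w = (\<Sum>j. xi (m, int_decode j) w *\<^sub>R u m (int_decode j))" for w
  proof -
    have "((\<lambda>j. xi (m, int_decode j) w *\<^sub>R u m (int_decode j)) has_sum X m w) UNIV"
      using X_has_sum by (subst has_sum_reindex_bij_betw[OF bij_int_decode])
    then show ?thesis by (metis has_sum_imp_sums sums_unique)
  qed
  then have "X m = (\<lambda>w. \<Sum>j. xi (m, int_decode j) w *\<^sub>R u m (int_decode j))" by auto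
  then show ?thesis by simp
qed

lemma measurable_Y [measurable]: "Y \<in> borel_measurable W"
  unfolding Y_def [abs_def] by simp

lemma active_sets [measurable]: "active m \<in> sets W"
proof -
  have "active m = (\<Union>k\<in>F m. {w. xi (m, k) w \<noteq> 0})" by (auto simp: active_def)
  then show ?thesis by (simp only:) (intro sets.finite_UN, auto)
qed

lemma prob_active: "P.prob (active m) \<le> card (F m) * p m"
proof -
  have "active m = (\<Union>k\<in>F m. {w. xi (m, k) w \<noteq> 0})" by (auto simp: active_def)
  then have "P.prob (active m) \<le> (\<Sum>k\<in>F m. P.prob {w. xi (m, k) w \<noteq> 0})"
    by (simp only:) (rule P.finite_measure_subadditive_finite, auto)
  then show ?thesis by (simp add: prob_xi_nonzero)
qed

lemma norm_X_inactive: "w \<notin> active m \<Longrightarrow> norm (X m w) \<le> 2 * (1/2) ^ m"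
  unfolding X_def by (rule norm_signed_small[where G="F m"]) (use xi_range u_tail in \<open>auto simp: active_def\<close>)

lemma norm_X_le: "norm (X m w) \<le> 2 * (1/2) ^ m + D m * indicator (active m) w"
proof (cases "w \<in> active m")
  case True
  have "norm (X m w) \<le> D m" unfolding X_def by (rule norm_signed_le) (rule xi_range)
  then show ?thesis using True by (simp add: add_increasing)
qed (use norm_X_inactive in auto)

lemma summable_active: "summable (\<lambda>n. P.prob (active n) * exp (\<Sum>j\<le>n. 2 * D j))"
proof (rule summable_comparison_test'[of "\<lambda>n. (1/4) ^ Suc n" 0])
  show "summable (\<lambda>n. (1/4 :: real) ^ Suc n)" by (simp add: summable_Suc_iff summable_geometric)
  fix n
  have "P.prob (active n) \<le> (1 + card (F n)) * p n"
    using prob_active[of n] p_pos[of n] by (simp add: algebra_simps)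
  then have "P.prob (active n) * exp (\<Sum>j\<le>n. 2 * D j) \<le> (1/4) ^ Suc n * (exp (- 2 * (\<Sum>n\<le>n. D n)) * exp (\<Sum>j\<le>n. 2 * D j))"
    unfolding card_p by (simp add: mult_ac)
  \<comment> \<open>Here the exponential factor of \<open>p\<close> is spent in full.\<close>
  also have "exp (- 2 * (\<Sum>n\<le>n. D n)) * exp (\<Sum>j\<le>n. 2 * D j) = 1"
    by (simp add: exp_add[symmetric] sum_distrib_left sum_negf)
  finally show "norm (P.prob (active n) * exp (\<Sum>j\<le>n. 2 * D j)) \<le> (1/4) ^ Suc n" by simp
qed

lemma AE_inactive: "AE w in W. eventually (\<lambda>n. w \<notin> active n) sequentially"
  by (rule P.exp_sum_indicator(1)[OF active_sets _ summable_active]) (simp add: D_nonneg)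

lemma integrable_exp_active: "integrable W (\<lambda>w. exp (\<Sum>n. 2 * D n * indicator (active n) w))"
  by (rule P.exp_sum_indicator(2)[OF active_sets _ summable_active]) (simp add: D_nonneg)

lemma summable_active_indicator:
  assumes "eventually (\<lambda>n. w \<notin> active n) sequentially"
  shows "summable (\<lambda>n. c n * indicator (active n) w :: real)"
proof -
  from assms have "eventually (\<lambda>n. norm (c n * indicator (active n) w) \<le> 0) sequentially"
    by eventually_elim auto
  then show ?thesis by (rule summable_comparison_test_ev[OF _ summable_zero])
qed

lemma summable_norm_X:
  assumes "eventually (\<lambda>n. w \<notin> active n) sequentially"
  shows "summable (\<lambda>m. norm (X m w))" "norm (Y w) \<le> 4 + (\<Sum>n. D n * indicator (active n) w)"
proof -
  have geo: "(\<lambda>m. 2 * (1/2) ^ m :: real) sums (2 * 2)"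
    using geometric_sums[of "1/2 :: real"] by (intro sums_mult) simp
  note s = summable_active_indicator[OF assms, of D]
  have s': "summable (\<lambda>m. 2 * (1/2) ^ m + D m * indicator (active m) w)"
    using geo s by (intro summable_add) (auto simp: sums_iff)
  then show *: "summable (\<lambda>m. norm (X m w))"
    by (rule summable_comparison_test'[of _ 0]) (simp add: norm_X_le)
  have "norm (Y w) \<le> (\<Sum>m. norm (X m w))"
    unfolding Y_def by (rule summable_norm[OF *])
  also have "\<dots> \<le> (\<Sum>m. 2 * (1/2) ^ m + D m * indicator (active m) w)"
    by (intro suminf_le norm_X_le * s')
  also have "\<dots> = 4 + (\<Sum>n. D n * indicator (active n) w)"
    using geo s by (subst suminf_add[symmetric]) (auto simp: sums_iff)
  finally show "norm (Y w) \<le> 4 + (\<Sum>n. D n * indicator (active n) w)" .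
qed

lemma integrable_exp_norm_Y: "integrable W (\<lambda>w. exp (2 * norm (Y w)))"
proof (rule Bochner_Integration.integrable_bound)
  \<comment> \<open>The 8 is twice 4, the sum over all \<open>m\<close> of the bounds
    \<open>2 * (1/2) ^ m\<close> for inactive blocks.\<close>
  show "integrable W (\<lambda>w. exp 8 * exp (\<Sum>n. 2 * D n * indicator (active n) w))"
    by (intro integrable_mult_right integrable_exp_active)
  show "AE w in W. norm (exp (2 * norm (Y w))) \<le> norm (exp 8 * exp (\<Sum>n. 2 * D n * indicator (active n) w))"
    using AE_inactive
  proof eventually_elim
    case (elim w)
    have "2 * norm (Y w) \<le> 8 + 2 * (\<Sum>n. D n * indicator (active n) w)"
      using summable_norm_X(2)[OF elim] by simp
    also have "2 * (\<Sum>n. D n * indicator (active n) w) = (\<Sum>n. 2 * D n * indicator (active n) w)"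
      using summable_active_indicator[OF elim, of D] by (simp add: suminf_mult mult.assoc)
    finally show ?case by (simp add: exp_add[symmetric])
  qed
qed simp

end

section \<open>Invariance, mixing and full support of the law\<close>

locale orbit_series = random_series u F
  for u :: "nat \<Rightarrow> int \<Rightarrow> 'a::{banach, second_countable_topology}" and F :: "nat \<Rightarrow> int set" +
  fixes T :: "'a \<Rightarrow> 'a"
  assumes T_linear: "bounded_linear T" and T_u: "T (u m k) = u m (k + 1)"
begin

lemma bounded_linear_funpow: "bounded_linear (T ^^ n)"
proof (induction n)
  case 0
  show ?case using bounded_linear_ident by (simp add: id_def)
next
  case (Suc n)
  show ?case using bounded_linear_compose[OF T_linear Suc] by (simp add: o_def)
qed

lemma measurable_funpow [measurable]: "T ^^ n \<in> borel_measurable borel"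
  by (intro borel_measurable_continuous_onI bounded_linear.continuous_on[OF bounded_linear_funpow] continuous_on_id)

lemma funpow_u: "(T ^^ n) (u m k) = u m (k + int n)"
  by (induction n) (simp_all add: T_u algebra_simps)

lemma X_translate: "X m (translate n w) = (T ^^ n) (X m w)"
proof -
  interpret Tn: bounded_linear "T ^^ n" by (rule bounded_linear_funpow)
  have "((\<lambda>k. (T ^^ n) (xi (m, k) w *\<^sub>R u m k)) has_sum (T ^^ n) (X m w)) UNIV"
    by (rule has_sum_bounded_linear[OF bounded_linear_funpow X_has_sum])
  then have "((\<lambda>k. (\<lambda>k. xi (m, k - int n) w *\<^sub>R u m k) (k + int n)) has_sum (T ^^ n) (X m w)) UNIV"
    by (simp add: Tn.scaleR funpow_u)
  moreover have "bij_betw (\<lambda>k. k + int n) UNIV UNIV"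
    by (rule bij_betw_byWitness[where f'="\<lambda>k. k - int n"]) auto
  ultimately have "((\<lambda>k. xi (m, k - int n) w *\<^sub>R u m k) has_sum (T ^^ n) (X m w)) UNIV"
    by (subst (asm) has_sum_reindex_bij_betw[where g="\<lambda>k. k + int n" and B=UNIV])
  then show ?thesis
    unfolding X_def xi_translate by (rule infsumI)
qed

text \<open>Continuity carries the operator through the outer series, which requires its
  convergence; the identity thus holds almost surely, whereas \<open>X_translate\<close> holds
  everywhere.\<close>

lemma Y_translate:
  assumes "eventually (\<lambda>n. w \<notin> active n) sequentially"
  shows "Y (translate n w) = (T ^^ n) (Y w)"
proof -
  have "summable (\<lambda>m. X m w)"
    using summable_norm_X(1)[OF assms] by (rule summable_norm_cancel)
  then show ?thesis
    unfolding Y_def X_translate by (rule bounded_linear.suminf[OF bounded_linear_funpow, symmetric])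
qed

definition law :: "'a measure" where
  "law = distr W borel Y"

lemma prob_space_law: "prob_space law"
  unfolding law_def by (rule P.prob_space_distr) simp

lemma sets_law: "sets law = sets borel" and space_law: "space law = UNIV"
  by (simp_all add: law_def)

lemma vimage_Y_sets: "A \<in> sets borel \<Longrightarrow> Y -` A \<in> sets W"
  using measurable_sets[OF measurable_Y, of A] by simp

text \<open>Up to a null set \<open>Y\<close> intertwines the shift with \<open>T\<close>, so
  correlations of the law are correlations of the product shift. Invariance is the case
  \<open>A = UNIV\<close>, \<open>n = 1\<close>; mixing is the limit in \<open>n\<close>.\<close>

lemma measure_law_inter:
  assumes A: "A \<in> sets borel" and B: "B \<in> sets borel"
  shows "measure law (A \<inter> (T ^^ n) -` B) = P.prob (Y -` A \<inter> translate n -` (Y -` B))"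
proof -
  have TB: "(T ^^ n) -` B \<in> sets borel"
    using measurable_sets[OF measurable_funpow B, of n] by simp
  have "measure law (A \<inter> (T ^^ n) -` B) = P.prob (Y -` (A \<inter> (T ^^ n) -` B))"
    unfolding law_def using A TB by (simp add: measure_distr)
  also have "\<dots> = P.prob (Y -` A \<inter> translate n -` (Y -` B))"
  proof (rule P.finite_measure_eq_AE)
    show "AE w in W. (w \<in> Y -` (A \<inter> (T ^^ n) -` B)) = (w \<in> Y -` A \<inter> translate n -` (Y -` B))"
      using AE_inactive by eventually_elim (simp add: Y_translate)
    show "Y -` (A \<inter> (T ^^ n) -` B) \<in> sets W"
      using A TB by (intro vimage_Y_sets sets.Int)
    show "Y -` A \<inter> translate n -` (Y -` B) \<in> sets W"
      using A B by (intro sets.Int translate_vimage_sets vimage_Y_sets)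
  qed
  finally show ?thesis .
qed

lemma measure_law: "A \<in> sets borel \<Longrightarrow> measure law A = P.prob (Y -` A)"
  unfolding law_def by (simp add: measure_distr)

lemma law_invariant:
  assumes "A \<in> sets borel"
  shows "emeasure law (T -` A) = emeasure law A"
proof -
  interpret law: prob_space law by (rule prob_space_law)
  have "measure law (T -` A) = P.prob (translate 1 -` (Y -` A))"
    using measure_law_inter[of UNIV A 1] assms by simp
  also have "\<dots> = measure law A"
    using assms by (simp add: measure_translate vimage_Y_sets measure_law)
  finally show ?thesis by (simp add: law.emeasure_eq_measure)
qed

lemma law_strongly_mixing:
  assumes "A \<in> sets borel" "B \<in> sets borel"
  shows "(\<lambda>n. measure law (A \<inter> (T ^^ n) -` B)) \<longlonglongrightarrow> measure law A * measure law B"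
  using strong_mixing[OF vimage_Y_sets vimage_Y_sets, OF assms] assms
  by (simp only: measure_law_inter measure_law)

end

section \<open>Full support: prescribed sign patterns have positive probability\<close>

lemma one_minus_sum_le_prod:
  fixes a :: "'i \<Rightarrow> real"
  assumes "\<And>i. i \<in> A \<Longrightarrow> 0 \<le> a i \<and> a i \<le> 1"
  shows "1 - (\<Sum>i\<in>A. a i) \<le> (\<Prod>i\<in>A. 1 - a i)"
  using assms
proof (induction A rule: infinite_finite_induct)
  case (insert i A)
  then have "(\<Prod>j\<in>A. 1 - a j) \<le> 1" "1 - sum a A \<le> (\<Prod>j\<in>A. 1 - a j)"
    by (auto intro!: prod_le_1)
  moreover from this(1) have "a i * (\<Prod>j\<in>A. 1 - a j) \<le> a i * 1"
    using insert.prems by (intro mult_left_mono) auto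
  ultimately show ?case using insert.hyps by (simp add: algebra_simps)
qed simp_all

context coin_shift
begin

lemma xi_eq_sets: "{w. xi i w = c} \<in> sets W"
  using measurable_sets[OF measurable_xi, of "{c}" i] by (simp add: vimage_def)

lemma prob_coin_sign:
  "measure_pmf.prob (coin (p m)) {b. coin_sign b = 0} = 1 - p m"
  "measure_pmf.prob (coin (p m)) {b. coin_sign b = 1} = p m / 2"
proof -
  have "measure_pmf.prob (coin (p m)) {b. coin_sign b = c}
      = measure_pmf.expectation (coin (p m)) (indicator {b. coin_sign b = c})" for c
    by simp
  then show "measure_pmf.prob (coin (p m)) {b. coin_sign b = 0} = 1 - p m"
    "measure_pmf.prob (coin (p m)) {b. coin_sign b = 1} = p m / 2"
    by (simp_all only: integral_coin[OF less_imp_le[OF p_pos] p_le_1])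
      (simp_all add: coin_sign_def indicator_def)
qed

end

context random_series
begin

lemma p_le_quarter: "p m \<le> (1/4) ^ Suc m"
proof -
  have "exp (- 2 * (\<Sum>n\<le>m. D n)) * (1/4) ^ Suc m \<le> 1 * (1/4) ^ Suc m"
    by (intro mult_right_mono) (simp_all add: sum_nonneg D_nonneg)
  then show ?thesis by (intro order_trans[OF p_le[of m]]) simp
qed

lemma card_p_le: "card (F m) * p m \<le> (1/4) ^ Suc m"
proof -
  have "card (F m) * p m \<le> (1 + card (F m)) * p m"
    using p_pos[of m] by (simp add: algebra_simps)
  also have "\<dots> \<le> 1 * (1/4) ^ Suc m"
    unfolding card_p by (intro mult_right_mono) (simp_all add: sum_nonneg D_nonneg)
  finally show ?thesis by simp
qed

lemma sum_quarter_le: "(\<Sum>m\<in>{N..<M}. (1/4 :: real) ^ Suc m) \<le> 1 / 2"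
proof -
  have *: "(\<Sum>m<M. (1/4 :: real) ^ Suc m) = (1 - (1/4) ^ M) / 3" for M
    by (induction M) (simp_all add: diff_divide_distrib)
  have "(\<Sum>m\<in>{N..<M}. (1/4 :: real) ^ Suc m) \<le> (\<Sum>m<M. (1/4 :: real) ^ Suc m)"
    by (intro sum_mono2) auto
  also have "\<dots> \<le> 1 / 2"
  proof -
    have "(1 - z) / 3 \<le> 1 / 2" if "0 \<le> z" for z :: real using that by simp
    from this[of "(1/4) ^ M"] show ?thesis unfolding * by simp
  qed
  finally show ?thesis .
qed

text \<open>Finitely many prescribed values have positive probability \<open>q\<close> because
  \<open>0 < p m < 1\<close>. Silence of all windows from \<open>N\<close> on costs at most a factor
  1/2: the expected number of nonzero signs in them is at most 1/2, and the Weierstrass product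
  inequality turns this into a lower bound for the product. The bound \<open>q / 2\<close> is free
  of \<open>M\<close> and survives the decreasing limit.\<close>

lemma prob_pattern_pos:
  assumes J1: "finite J1" "\<And>i. i \<in> J1 \<Longrightarrow> fst i < N"
  shows "P.prob {w. (\<forall>i\<in>J1. xi i w = (if i \<in> J then 1 else 0)) \<and> (\<forall>m\<ge>N. w \<notin> active m)} > 0"
proof -
  \<comment> \<open>The test \<open>fst i < N\<close> prescribes 0 in all later blocks, even at
    indices in \<open>J\<close>.\<close>
  define B where "B i = {b. coin_sign b = (if fst i < N \<and> i \<in> J then 1 else 0)}" for i :: "nat \<times> int"
  define J2 where "J2 M = (SIGMA m:{N..<M}. F m)" for M
  define E where "E M = {w. \<forall>i\<in>J1 \<union> J2 M. w i \<in> B i}" for M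
  define q where "q = (\<Prod>i\<in>J1. measure_pmf.prob (coin (p (fst i))) (B i))"
  have J2: "finite (J2 M)" "J1 \<inter> J2 M = {}" for M
    unfolding J2_def using J1(2) by (force simp del: finite_F intro: finite_SigmaI finite_F)+
  have "measure_pmf.prob (coin (p (fst i))) (B i) > 0" for i
  proof -
    have "(1/4 :: real) ^ Suc (fst i) \<le> 1 / 4" using power_le_one[of "1/4 :: real" "fst i"] by simp
    then have "p (fst i) < 1" using p_le_quarter[of "fst i"] by linarith
    then show ?thesis using p_pos[of "fst i"] by (simp add: B_def prob_coin_sign)
  qed
  then have q: "q > 0" unfolding q_def by (intro prod_pos) auto
  have prob_E: "P.prob (E M) \<ge> q / 2" for M
  proof -
    have "1 / 2 \<le> 1 - (\<Sum>m\<in>{N..<M}. (1/4 :: real) ^ Suc m)"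
      using sum_quarter_le[of N M] by linarith
    also have "\<dots> \<le> 1 - (\<Sum>m\<in>{N..<M}. \<Sum>k\<in>F m. p m)"
      by (intro diff_left_mono sum_mono) (use card_p_le in simp)
    also have "\<dots> = 1 - (\<Sum>i\<in>J2 M. p (fst i))"
      unfolding J2_def by (subst sum.Sigma) (simp_all add: split_beta)
    also have "\<dots> \<le> (\<Prod>i\<in>J2 M. 1 - p (fst i))"
      by (rule one_minus_sum_le_prod) (use p_pos p_le_1 in \<open>auto intro: less_imp_le\<close>)
    also have "\<dots> = (\<Prod>i\<in>J2 M. measure_pmf.prob (coin (p (fst i))) (B i))"
      by (intro prod.cong refl) (auto simp: J2_def B_def prob_coin_sign)
    finally have "q * (1 / 2) \<le> q * (\<Prod>i\<in>J2 M. measure_pmf.prob (coin (p (fst i))) (B i))"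
      using q by (intro mult_left_mono) auto
    also have "\<dots> = (\<Prod>i\<in>J1 \<union> J2 M. measure_pmf.prob (coin (p (fst i))) (B i))"
      unfolding q_def using J1 J2 by (simp add: prod.union_disjoint)
    also have "\<dots> = P.prob (E M)"
      unfolding E_def using J1 J2 by (intro measure_box[symmetric]) auto
    finally show ?thesis by simp
  qed
  have E_sets: "E M \<in> sets W" for M
  proof -
    have "E M = {w \<in> space W. \<forall>i\<in>J1 \<union> J2 M. xi i w = (if fst i < N \<and> i \<in> J then 1 else 0)}"
      by (simp add: E_def B_def xi_def)
    also have "\<dots> \<in> sets W"
      using J1 J2 by (intro sets.sets_Collect_finite_All) (auto simp: xi_eq_sets)
    finally show ?thesis .
  qed
  have E_eq: "(\<Inter>M. E M) = {w. (\<forall>i\<in>J1. xi i w = (if i \<in> J then 1 else 0)) \<and> (\<forall>m\<ge>N. w \<notin> active m)}"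
    (is "_ = ?R")
  proof (intro set_eqI iffI)
    fix w assume w: "w \<in> (\<Inter>M. E M)"
    then have w': "w i \<in> B i" if "i \<in> J1 \<union> J2 M" for i M using that by (auto simp: E_def)
    have "xi i w = (if i \<in> J then 1 else 0)" if "i \<in> J1" for i
      using w'[of i 0] that J1(2)[OF that] by (simp add: B_def xi_def)
    moreover have "xi (m, k) w = 0" if "m \<ge> N" "k \<in> F m" for m k
      using w'[of "(m, k)" "Suc m"] that by (simp add: B_def xi_def J2_def)
    ultimately show "w \<in> ?R" by (auto simp: active_def)
  next
    fix w assume w: "w \<in> ?R"
    have "w i \<in> B i" if "i \<in> J1" for i
      using w that J1(2)[OF that] by (simp add: B_def xi_def)
    moreover have "w i \<in> B i" if "i \<in> J2 M" for i M
      using w that by (auto simp: B_def xi_def J2_def active_def)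
    ultimately show "w \<in> (\<Inter>M. E M)" by (auto simp: E_def)
  qed
  have "decseq E"
    unfolding decseq_def E_def J2_def by fastforce
  then have "(\<lambda>M. P.prob (E M)) \<longlonglongrightarrow> P.prob (\<Inter>M. E M)"
    using E_sets by (intro P.finite_Lim_measure_decseq) auto
  then have "q / 2 \<le> P.prob (\<Inter>M. E M)"
    by (rule LIMSEQ_le_const) (use prob_E in auto)
  then show ?thesis unfolding E_eq using q by linarith
qed

text \<open>Block \<open>m < N\<close> is steered to its partial sum over \<open>K m\<close> by
  fixing the signs on \<open>K m\<close> and on a finite set \<open>G m\<close> off which every
  subset sum is small; its other signs stay free. Blocks from \<open>N\<close> on are kept inactive
  and add up to a small error.\<close>

lemma prob_ball_pos:
  assumes J: "finite J" and y: "norm (y - (\<Sum>(m, k)\<in>J. u m k)) < \<epsilon> / 2" and e: "\<epsilon> > 0"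
  shows "P.prob (Y -` ball y \<epsilon>) > 0"
proof -
  obtain N0 where N0: "(1/2 :: real) ^ N0 < \<epsilon> / 16"
    using real_arch_pow_inv[of "\<epsilon> / 16" "1/2"] e by auto
  obtain b where b: "fst i < b" if "i \<in> J" for i
  proof -
    have "finite (fst ` J)" using J by simp
    then show thesis using that unfolding finite_nat_set_iff_bounded by blast
  qed
  define N where "N = max N0 b"
  have "(1/2 :: real) ^ N \<le> (1/2) ^ N0" unfolding N_def by (intro power_decreasing) auto
  with N0 have N: "4 * (1/2 :: real) ^ N < \<epsilon> / 4" by linarith
  \<comment> \<open>\<open>N\<close> blocks with error at most \<open>2 * \<delta>\<close> each
    contribute at most a quarter of \<epsilon>; \<open>N + 1\<close> covers
    \<open>N = 0\<close>.\<close>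
  define \<delta> where "\<delta> = \<epsilon> / (8 * (real N + 1))"
  have \<delta>: "\<delta> > 0" unfolding \<delta>_def using e by (intro divide_pos_pos) auto
  have "\<exists>G. finite G \<and> (\<forall>A. A \<inter> G = {} \<longrightarrow> norm (infsum (u m) A) \<le> \<delta>)" for m
    using summable_on_tail[OF u_summable \<delta>, of m] by metis
  then obtain G where G: "finite (G m)" "A \<inter> G m = {} \<Longrightarrow> norm (infsum (u m) A) \<le> \<delta>" for m A
    by metis
  define K where "K m = {k. (m, k) \<in> J}" for m
  have K: "finite (K m)" for m
  proof -
    have "K m \<subseteq> snd ` J" by (force simp: K_def)
    then show ?thesis using J finite_subset by blast
  qed
  define J1 where "J1 = (SIGMA m:{..<N}. G m \<union> K m)"
  have J_eq: "J = (SIGMA m:{..<N}. K m)"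
    using b by (fastforce simp: K_def N_def)
  define E where "E = {w. (\<forall>i\<in>J1. xi i w = (if i \<in> J then 1 else 0)) \<and> (\<forall>m\<ge>N. w \<notin> active m)}"
  have "P.prob E > 0"
    unfolding E_def by (rule prob_pattern_pos) (auto simp: J1_def G K)
  moreover have "E \<subseteq> Y -` ball y \<epsilon>"
  proof
    fix w assume w: "w \<in> E"
    then have inactive: "w \<notin> active m" if "m \<ge> N" for m using that by (simp add: E_def)
    then have ev: "eventually (\<lambda>n. w \<notin> active n) sequentially"
      unfolding eventually_sequentially by blast
    have s: "summable (\<lambda>m. X m w)"
      using summable_norm_X(1)[OF ev] by (rule summable_norm_cancel)
    have block: "norm (X m w - (\<Sum>k\<in>K m. u m k)) \<le> 2 * \<delta>" if m: "m < N" for m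
    proof -
      \<comment> \<open>The difference of the two coefficient families vanishes on
        \<open>G m\<close> and \<open>K m\<close> and is the sign elsewhere. It therefore still
        takes values in -1, 0, 1, and the estimate for signed sums applies to it.\<close>
      let ?e = "\<lambda>k. xi (m, k) w - (if k \<in> K m then 1 else 0)"
      have xi: "xi (m, k) w = (if k \<in> K m then 1 else 0)" if "k \<in> G m \<union> K m" for k
        using w that m by (auto simp: E_def J1_def K_def)
      have "((\<lambda>k. if k \<in> K m then u m k else 0) has_sum (\<Sum>k\<in>K m. u m k)) UNIV"
        using has_sum_finite[OF K, of "u m" m]
        by (subst has_sum_cong_neutral[where g="u m" and T="K m"]) auto
      then have "((\<lambda>k. - (if k \<in> K m then u m k else 0)) has_sum - (\<Sum>k\<in>K m. u m k)) UNIV"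
        by (simp only: has_sum_uminus minus_minus)
      then have "((\<lambda>k. xi (m, k) w *\<^sub>R u m k + - (if k \<in> K m then u m k else 0))
          has_sum (X m w + - (\<Sum>k\<in>K m. u m k))) UNIV"
        by (rule has_sum_add[OF X_has_sum])
      also have "(\<lambda>k. xi (m, k) w *\<^sub>R u m k + - (if k \<in> K m then u m k else 0)) = (\<lambda>k. ?e k *\<^sub>R u m k)"
        by (auto simp: fun_eq_iff algebra_simps)
      finally have "X m w - (\<Sum>k\<in>K m. u m k) = (\<Sum>\<^sub>\<infinity>k. ?e k *\<^sub>R u m k)"
        by (simp add: infsumI)
      moreover have "norm (\<Sum>\<^sub>\<infinity>k. ?e k *\<^sub>R u m k) \<le> 2 * \<delta>"
      proof (rule norm_signed_small[where G="G m"])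
        show "?e k \<in> {-1, 0, 1}" for k
          using xi[of k] xi_range[of "(m, k)" w] by (cases "k \<in> K m") auto
      qed (use G xi in auto)
      ultimately show ?thesis by simp
    qed
    have "Y w = (\<Sum>m. X (m + N) w) + (\<Sum>m<N. X m w)"
      unfolding Y_def by (rule suminf_split_initial_segment[OF s])
    moreover have "(\<Sum>(m, k)\<in>J. u m k) = (\<Sum>m<N. \<Sum>k\<in>K m. u m k)"
      using sum.Sigma[of "{..<N}" K u] K unfolding J_eq by simp
    ultimately have "Y w - (\<Sum>(m, k)\<in>J. u m k)
        = (\<Sum>m. X (m + N) w) + (\<Sum>m<N. X m w - (\<Sum>k\<in>K m. u m k))"
      by (simp add: sum_subtractf)
    also have "norm \<dots> \<le> norm (\<Sum>m. X (m + N) w) + (\<Sum>m<N. norm (X m w - (\<Sum>k\<in>K m. u m k)))"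
      by (intro order_trans[OF norm_triangle_ineq] add_left_mono norm_sum)
    also have "(\<Sum>m<N. norm (X m w - (\<Sum>k\<in>K m. u m k))) \<le> (\<Sum>m<N. 2 * \<delta>)"
      using block by (intro sum_mono) auto
    also have "\<dots> \<le> \<epsilon> / 4"
      using e unfolding \<delta>_def by (simp add: field_simps)
    also have "norm (\<Sum>m. X (m + N) w) \<le> 4 * (1/2) ^ N"
    proof -
      have geo: "(\<lambda>m. 2 * (1/2) ^ N * (1/2) ^ m :: real) sums (2 * (1/2) ^ N * 2)"
        using geometric_sums[of "1/2 :: real"] by (intro sums_mult) simp
      have "norm (\<Sum>m. X (m + N) w) \<le> (\<Sum>m. 2 * (1/2) ^ N * (1/2) ^ m)"
      proof (rule norm_suminf_le)
        show "norm (X (m + N) w) \<le> 2 * (1/2) ^ N * (1/2) ^ m" for m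
          using norm_X_inactive[OF inactive, of "m + N"] by (simp add: power_add mult_ac)
      qed (use geo in \<open>simp add: sums_iff\<close>)
      then show ?thesis using geo by (simp add: sums_iff)
    qed
    finally have "norm (Y w - (\<Sum>(m, k)\<in>J. u m k)) < \<epsilon> / 2" using N by simp
    with y have "norm (y - Y w) < \<epsilon>"
      using norm_triangle_ineq[of "y - (\<Sum>(m, k)\<in>J. u m k)" "(\<Sum>(m, k)\<in>J. u m k) - Y w"]
      by (simp add: norm_minus_commute)
    then show "w \<in> Y -` ball y \<epsilon>" by (simp add: dist_norm)
  qed
  moreover have "Y -` ball y \<epsilon> \<in> sets W"
    using measurable_sets[OF measurable_Y, of "ball y \<epsilon>"] by simp
  ultimately show ?thesis
    using P.finite_measure_mono[of E "Y -` ball y \<epsilon>"] by linarith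
qed

end

section \<open>Series in \<open>L\<^sup>1\<close> and characteristic functions\<close>

lemma series_L1:
  fixes f :: "nat \<Rightarrow> 'b \<Rightarrow> real"
  assumes f: "\<And>l. integrable M (f l)" and s: "summable (\<lambda>l. \<integral>x. \<bar>f l x\<bar> \<partial>M)"
  shows "AE x in M. summable (\<lambda>l. \<bar>f l x\<bar>)"
    and "integrable M (\<lambda>x. \<Sum>l. f l x)"
    and "(\<integral>x. (\<Sum>l. f l x) \<partial>M) = (\<Sum>l. \<integral>x. f l x \<partial>M)"
    and "(\<integral>x. \<bar>\<Sum>l. f l x\<bar> \<partial>M) \<le> (\<Sum>l. \<integral>x. \<bar>f l x\<bar> \<partial>M)"
proof -
  have [measurable]: "f l \<in> borel_measurable M" for l using f by auto
  have "(\<integral>\<^sup>+x. (\<Sum>l. ennreal \<bar>f l x\<bar>) \<partial>M) = (\<Sum>l. \<integral>\<^sup>+x. ennreal \<bar>f l x\<bar> \<partial>M)"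
    by (rule nn_integral_suminf) simp
  also have "\<dots> = (\<Sum>l. ennreal (\<integral>x. \<bar>f l x\<bar> \<partial>M))"
    using f by (intro suminf_cong nn_integral_eq_integral) auto
  also have "\<dots> = ennreal (\<Sum>l. \<integral>x. \<bar>f l x\<bar> \<partial>M)"
    using s by (intro suminf_ennreal2) auto
  finally have "(\<integral>\<^sup>+x. (\<Sum>l. ennreal \<bar>f l x\<bar>) \<partial>M) \<noteq> \<infinity>" by simp
  then have "AE x in M. (\<Sum>l. ennreal \<bar>f l x\<bar>) \<noteq> \<infinity>"
    by (intro nn_integral_noteq_infinite) auto
  then show ae: "AE x in M. summable (\<lambda>l. \<bar>f l x\<bar>)"
    by eventually_elim (auto intro: summable_suminf_not_top)
  have ae': "AE x in M. summable (\<lambda>l. norm (f l x))" "AE x in M. summable (\<lambda>l. norm \<bar>f l x\<bar>)"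
    using ae by simp_all
  have s': "summable (\<lambda>l. \<integral>x. norm (f l x) \<partial>M)" "summable (\<lambda>l. \<integral>x. norm \<bar>f l x\<bar> \<partial>M)"
    using s by simp_all
  have f': "integrable M (\<lambda>x. \<bar>f l x\<bar>)" for l using f by simp
  show int: "integrable M (\<lambda>x. \<Sum>l. f l x)"
    by (rule integrable_suminf[OF f ae'(1) s'(1)])
  show "(\<integral>x. (\<Sum>l. f l x) \<partial>M) = (\<Sum>l. \<integral>x. f l x \<partial>M)"
    by (rule integral_suminf[OF f ae'(1) s'(1)])
  have "(\<integral>x. \<bar>\<Sum>l. f l x\<bar> \<partial>M) \<le> (\<integral>x. (\<Sum>l. \<bar>f l x\<bar>) \<partial>M)"
  proof (rule integral_mono_AE)
    show "integrable M (\<lambda>x. \<bar>\<Sum>l. f l x\<bar>)" using int by simp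
    show "integrable M (\<lambda>x. \<Sum>l. \<bar>f l x\<bar>)"
      by (rule integrable_suminf[OF f' ae'(2) s'(2)])
    show "AE x in M. \<bar>\<Sum>l. f l x\<bar> \<le> (\<Sum>l. \<bar>f l x\<bar>)"
      using ae by eventually_elim (rule summable_rabs)
  qed
  also have "\<dots> = (\<Sum>l. \<integral>x. \<bar>f l x\<bar> \<partial>M)"
    by (rule integral_suminf[OF f' ae'(2) s'(2)])
  finally show "(\<integral>x. \<bar>\<Sum>l. f l x\<bar> \<partial>M) \<le> (\<Sum>l. \<integral>x. \<bar>f l x\<bar> \<partial>M)" .
qed

text \<open>Double series over blocks and positions become ordinary sequences along this
  enumeration, so that termwise integration and domination apply to them.\<close>

definition pair_decode :: "nat \<Rightarrow> nat \<times> int" where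
  "pair_decode l = map_prod id int_decode (prod_decode l)"

lemma bij_pair_decode: "bij pair_decode"
proof -
  have "bij (map_prod (id :: nat \<Rightarrow> nat) int_decode)"
    using bij_int_decode by (simp add: bij_def inj_on_def map_prod_def surj_def split_beta)
  then have "bij (map_prod id int_decode \<circ> prod_decode)"
    by (rule bij_comp[OF bij_prod_decode])
  then show ?thesis by (simp add: pair_decode_def[abs_def] o_def)
qed

lemma suminf_pair_decode:
  fixes f :: "nat \<times> int \<Rightarrow> real"
  assumes s: "summable (\<lambda>l. \<bar>f (pair_decode l)\<bar>)" and g: "\<And>m. ((\<lambda>k. f (m, k)) has_sum g m) UNIV"
  shows "(\<lambda>l. f (pair_decode l)) sums (\<Sum>m. g m)"
proof -
  have "(\<lambda>l. f (pair_decode l)) summable_on UNIV"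
    using s by (intro norm_summable_imp_summable_on) simp
  then obtain S where S: "((\<lambda>l. f (pair_decode l)) has_sum S) UNIV" by (auto simp: summable_on_def)
  then have "(f has_sum S) (UNIV \<times> UNIV)"
    by (subst (asm) has_sum_reindex_bij_betw[OF bij_pair_decode]) simp
  then have "(g has_sum S) UNIV"
    by (rule has_sum_SigmaD) (use g in auto)
  then have "g sums S" by (rule has_sum_imp_sums)
  then show ?thesis using has_sum_imp_sums[OF S] by (simp add: sums_iff)
qed

text \<open>Moving the summation window by one changes only its two end terms, at a cost of at most
  2. Repeating this gives a bound free of \<open>n\<close>.\<close>

lemma abs_sum_shift_diff_le:
  fixes f :: "int \<Rightarrow> real"
  assumes f: "\<And>k. \<bar>f k\<bar> \<le> 1"
  shows "\<bar>\<Sum>j<n. f (k - int j) - f (- int j)\<bar> \<le> 2 * \<bar>real_of_int k\<bar>"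
proof -
  have step: "\<bar>\<Sum>j<n. f (k + 1 - int j) - f (k - int j)\<bar> \<le> 2" for k
  proof -
    have "(\<Sum>j<n. f (k + 1 - int j) - f (k - int j)) = f (k + 1) - f (k + 1 - int n)"
      using sum_lessThan_telescope'[of "\<lambda>j. f (k + 1 - int j)" n] by simp
    then show ?thesis using f[of "k + 1"] f[of "k + 1 - int n"] by linarith
  qed
  have split: "(\<Sum>j<n. f (a - int j) - f (c - int j))
      = (\<Sum>j<n. f (a - int j) - f (b - int j)) + (\<Sum>j<n. f (b - int j) - f (c - int j))" for a b c
    by (simp add: sum.distrib[symmetric])
  show ?thesis
  proof (induction k rule: int_induct[where k=0])
    case base
    then show ?case by simp
  next
    case (step1 i)
    then show ?case using split[of "i + 1" 0 i] step[of i] by simp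
  next
    case (step2 i)
    have "(\<Sum>j<n. f (i - 1 - int j) - f (i - int j)) = - (\<Sum>j<n. f (i - 1 + 1 - int j) - f (i - 1 - int j))"
      by (simp add: sum_negf[symmetric])
    then show ?case using split[of "i - 1" 0 i] step[of "i - 1"] step2 by simp
  qed
qed

lemma cmod_iexp_diff_le: "cmod (iexp x - iexp y) \<le> \<bar>x - y\<bar>"
proof -
  have "iexp x - iexp y = iexp y * (iexp (x - y) - 1)"
    by (simp add: algebra_simps exp_add[symmetric])
  moreover have "cmod (iexp (x - y) - 1) \<le> \<bar>x - y\<bar>"
    using iexp_approx1[of "x - y" 0] by simp
  ultimately show ?thesis by (simp add: norm_mult)
qed

lemma real_distribution_normal: "real_distribution (density lborel (normal_density m \<sigma>))" if "\<sigma> > 0"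
  using that prob_space_normal_density[of \<sigma> m] by (auto simp: real_distribution_def real_distribution_axioms_def)

lemma char_normal:
  assumes "\<sigma> > 0"
  shows "char (density lborel (normal_density 0 \<sigma>)) t = exp (- ((\<sigma> * t)\<^sup>2) / 2)"
proof -
  interpret prob_space std_normal_distribution by (rule prob_space_normal_density) simp
  have "distributed std_normal_distribution lborel (\<lambda>x. x) std_normal_density"
    by (simp add: distributed_def distr_id2)
  then have "distributed std_normal_distribution lborel (\<lambda>x. \<sigma> * x) (normal_density 0 \<sigma>)"
    using normal_density_affine[of "\<lambda>x. x" 0 1 \<sigma> 0] assms by simp
  then have "density lborel (normal_density 0 \<sigma>) = distr std_normal_distribution lborel (\<lambda>x. \<sigma> * x)"
    by (simp add: distributed_def)
  then have "char (density lborel (normal_density 0 \<sigma>)) t = char std_normal_distribution (\<sigma> * t)"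
    by (simp add: char_def integral_distr mult_ac)
  then show ?thesis by (simp add: char_std_normal_distribution)
qed

lemma char_distr: "f \<in> borel_measurable M \<Longrightarrow> char (distr M borel f) t = (CLINT x|M. iexp (t * f x))"
  unfolding char_def by (subst integral_distr) auto

section \<open>Approximation of Birkhoff sums by i.i.d. sums\<close>

locale orbit_functional = orbit_series u F T
  for u :: "nat \<Rightarrow> int \<Rightarrow> 'a::{banach, second_countable_topology}" and F T +
  fixes h :: "'a \<Rightarrow> real" and K :: real
  assumes h_linear: "bounded_linear h" and K_nonneg: "K \<ge> 0" and h_bound: "\<bar>h x\<bar> \<le> K * norm x"
begin

interpretation h: bounded_linear h by (rule h_linear)

definition a :: "nat \<times> int \<Rightarrow> real" where
  "a i = h (u (fst i) (snd i))"

definition A :: "nat \<Rightarrow> real" where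
  "A m = (\<Sum>\<^sub>\<infinity>k. a (m, k))"

text \<open>In \<open>h ((T ^^ j) (Y w))\<close> the number \<open>a (m, k)\<close> carries the sign
  at position \<open>k - j\<close>. Freezing that sign at \<open>- j\<close> collects all numbers of
  block \<open>m\<close> into \<open>A m\<close>. Different \<open>j\<close> then use disjoint sets
  of coordinates, which makes the \<open>G j\<close> independent, and shift invariance makes them
  identically distributed.\<close>

definition G :: "nat \<Rightarrow> (nat \<times> int \<Rightarrow> bool \<times> bool) \<Rightarrow> real" where
  "G j w = (\<Sum>m. xi (m, - int j) w * A m)"

text \<open>Splitting by the sign of \<open>a\<close> leaves two sums of constant sign, each of them
  \<open>h\<close> applied to a subset sum of the vectors. In this way bounded subset sums become
  absolute summability of scalars.\<close>

lemma sum_abs_a_le: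
  assumes "finite H"
  shows "(\<Sum>k\<in>H. \<bar>a (m, k)\<bar>) \<le> K * D m"
proof -
  define Hp Hn where "Hp = {k \<in> H. a (m, k) \<ge> 0}" and "Hn = {k \<in> H. a (m, k) < 0}"
  have fin: "finite Hp" "finite Hn" using assms by (simp_all add: Hp_def Hn_def)
  have part: "\<bar>\<Sum>k\<in>B. a (m, k)\<bar> \<le> K * ((\<Sum>k\<in>F m. norm (u m k)) + (1/2) ^ m)" if "finite B" for B
  proof -
    have "(\<Sum>k\<in>B. a (m, k)) = h (\<Sum>k\<in>B. u m k)" by (simp add: a_def h.sum)
    also have "\<bar>\<dots>\<bar> \<le> K * norm (\<Sum>k\<in>B. u m k)" by (rule h_bound)
    also have "\<dots> \<le> K * ((\<Sum>k\<in>F m. norm (u m k)) + (1/2) ^ m)"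
      using norm_infsum_subset[of m B] that by (intro mult_left_mono K_nonneg) simp
    finally show ?thesis .
  qed
  have "H = Hp \<union> Hn" "Hp \<inter> Hn = {}" by (auto simp: Hp_def Hn_def)
  then have "(\<Sum>k\<in>H. \<bar>a (m, k)\<bar>) = (\<Sum>k\<in>Hp. \<bar>a (m, k)\<bar>) + (\<Sum>k\<in>Hn. \<bar>a (m, k)\<bar>)"
    using fin by (simp add: sum.union_disjoint)
  also have "\<dots> = (\<Sum>k\<in>Hp. a (m, k)) + (\<Sum>k\<in>Hn. - a (m, k))"
    by (intro arg_cong2[where f="(+)"] sum.cong) (auto simp: Hp_def Hn_def)
  also have "\<dots> \<le> K * D m"
    using part[OF fin(1)] part[OF fin(2)] by (simp add: sum_negf D_def algebra_simps)
  finally show ?thesis .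
qed

lemma a_abs_summable: "(\<lambda>k. \<bar>a (m, k)\<bar>) summable_on UNIV"
  by (rule nonneg_bdd_above_summable_on) (auto intro!: bdd_aboveI[of _ "K * D m"] sum_abs_a_le)

lemma infsum_abs_a_le: "(\<Sum>\<^sub>\<infinity>k. \<bar>a (m, k)\<bar>) \<le> K * D m"
  by (rule infsum_le_finite_sums[OF a_abs_summable sum_abs_a_le])

lemma a_has_sum: "((\<lambda>k. a (m, k)) has_sum A m) UNIV"
  unfolding A_def using a_abs_summable[of m] abs_summable_summable[of "\<lambda>k. a (m, k)" UNIV]
  by (intro has_sum_infsum) simp

lemma abs_A_le: "\<bar>A m\<bar> \<le> K * D m"
  using norm_infsum_bound[of "\<lambda>k. a (m, k)" UNIV] a_abs_summable[of m] infsum_abs_a_le[of m]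
  by (simp add: A_def)

text \<open>The square root halves the exponent. With \<open>S\<close> the sum of \<open>D\<close>
  up to \<open>m\<close>, the remaining \<open>exp (- S)\<close> absorbs \<open>D m\<close> because
  \<open>D m \<le> S \<le> exp S\<close>.\<close>

lemma sqrt_p_D_le: "sqrt (p m) * D m \<le> (1/2) ^ Suc m"
proof -
  let ?S = "\<Sum>n\<le>m. D n"
  have "p m \<le> (exp (- ?S) * (1/2) ^ Suc m)\<^sup>2"
  proof -
    have "exp (- 2 * ?S) = (exp (- ?S))\<^sup>2" using exp_double[of "- ?S"] by simp
    moreover have "(1/4 :: real) ^ Suc m = ((1/2) ^ Suc m)\<^sup>2"
      by (simp add: power_mult_distrib power_divide power2_eq_square flip: power_mult_distrib)
    ultimately show ?thesis using p_le[of m] by (simp only: power_mult_distrib)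
  qed
  then have "sqrt (p m) \<le> exp (- ?S) * (1/2) ^ Suc m"
    by (intro real_le_lsqrt) (auto simp: less_imp_le[OF p_pos])
  then have "sqrt (p m) * D m \<le> exp (- ?S) * (1/2) ^ Suc m * D m"
    by (intro mult_right_mono D_nonneg)
  also have "\<dots> = (exp (- ?S) * D m) * (1/2) ^ Suc m" by simp
  also have "\<dots> \<le> 1 * (1/2) ^ Suc m"
  proof (intro mult_right_mono)
    have "D m \<le> ?S" using D_nonneg by (intro member_le_sum) auto
    also have "?S \<le> exp ?S" using exp_ge_add_one_self[of ?S] by linarith
    finally have "exp (- ?S) * D m \<le> exp (- ?S) * exp ?S" by (intro mult_left_mono) auto
    then show "exp (- ?S) * D m \<le> 1" by (simp add: exp_minus)
  qed simp
  finally show ?thesis by simp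
qed

lemma p_le_sqrt: "p m \<le> sqrt (p m)"
  using p_pos[of m] p_le_1[of m] by (intro real_le_rsqrt) (simp add: power2_eq_square mult_le_cancel_left1)

lemma summable_half_power: "summable (\<lambda>m. K * (1/2 :: real) ^ Suc m)"
  by (intro summable_mult) (simp add: summable_Suc_iff summable_geometric)

text \<open>The summability behind the limit theorem: through \<open>p m \<le> sqrt (p m)\<close> it
  gives almost sure convergence of the double series, and as it stands it dominates the error after
  division by sqrt n.\<close>

lemma pair_summable: "summable (\<lambda>l. sqrt (p (fst (pair_decode l))) * \<bar>a (pair_decode l)\<bar>)"
proof -
  have "(\<lambda>i. sqrt (p (fst i)) * \<bar>a i\<bar>) summable_on (UNIV \<times> UNIV)"
  proof (rule summable_on_SigmaI)
    show "((\<lambda>k. sqrt (p (fst (m, k))) * \<bar>a (m, k)\<bar>) has_sum sqrt (p m) * (\<Sum>\<^sub>\<infinity>k. \<bar>a (m, k)\<bar>)) UNIV" for m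
      using has_sum_cmult_right[OF has_sum_infsum[OF a_abs_summable[of m]]] by simp
    have "sqrt (p m) * (\<Sum>\<^sub>\<infinity>k. \<bar>a (m, k)\<bar>) \<le> K * (1/2) ^ Suc m" for m
    proof -
      have "sqrt (p m) * (\<Sum>\<^sub>\<infinity>k. \<bar>a (m, k)\<bar>) \<le> sqrt (p m) * (K * D m)"
        using p_pos[of m] by (intro mult_left_mono infsum_abs_a_le) auto
      also have "\<dots> = K * (sqrt (p m) * D m)" by simp
      also have "\<dots> \<le> K * (1/2) ^ Suc m" by (intro mult_left_mono sqrt_p_D_le K_nonneg)
      finally show ?thesis .
    qed
    moreover have "0 \<le> sqrt (p m) * (\<Sum>\<^sub>\<infinity>k. \<bar>a (m, k)\<bar>)" for m
      using p_pos[of m] by (intro mult_nonneg_nonneg infsum_nonneg) auto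
    ultimately have "summable (\<lambda>m. norm (sqrt (p m) * (\<Sum>\<^sub>\<infinity>k. \<bar>a (m, k)\<bar>)))"
      by (intro summable_comparison_test'[OF summable_half_power, of 0]) simp
    then show "(\<lambda>m. sqrt (p m) * (\<Sum>\<^sub>\<infinity>k. \<bar>a (m, k)\<bar>)) summable_on UNIV"
      by (rule norm_summable_imp_summable_on)
  qed (use p_pos in \<open>auto intro!: mult_nonneg_nonneg intro: less_imp_le\<close>)
  then have "(\<lambda>l. sqrt (p (fst (pair_decode l))) * \<bar>a (pair_decode l)\<bar>) summable_on UNIV"
    by (subst summable_on_reindex_bij_betw[OF bij_pair_decode]) simp
  then show ?thesis by (rule summable_on_imp_summable)
qed

text \<open>The map \<phi> may displace positions but keeps the block, on which alone the
  distribution of a sign depends. This covers both the orbit series and the series with frozen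
  signs.\<close>

lemma AE_pair_summable:
  assumes \<phi>: "\<And>i. fst (\<phi> i) = fst i"
  shows "AE w in W. summable (\<lambda>l. \<bar>xi (\<phi> (pair_decode l)) w * a (pair_decode l)\<bar>)"
proof (rule series_L1(1))
  show "integrable W (\<lambda>w. xi (\<phi> (pair_decode l)) w * a (pair_decode l))" for l
    by (intro integrable_mult_left integrable_xi)
  show "summable (\<lambda>l. \<integral>w. \<bar>xi (\<phi> (pair_decode l)) w * a (pair_decode l)\<bar> \<partial>W)"
  proof (rule summable_comparison_test'[OF pair_summable, of 0])
    show "norm (\<integral>w. \<bar>xi (\<phi> (pair_decode l)) w * a (pair_decode l)\<bar> \<partial>W)
        \<le> sqrt (p (fst (pair_decode l))) * \<bar>a (pair_decode l)\<bar>" for l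
      using p_pos[of "fst (pair_decode l)"]
      by (simp add: abs_mult expectation_abs_xi \<phi> mult_right_mono p_le_sqrt)
  qed
qed

lemma h_X_has_sum: "((\<lambda>k. xi (m, k) w * a (m, k)) has_sum h (X m w)) UNIV"
  using has_sum_bounded_linear[OF h_linear X_has_sum[of m w]] by (simp add: h.scaleR a_def)

lemma AE_orbit_sums:
  "AE w in W. (\<lambda>l. xi (fst (pair_decode l), snd (pair_decode l) - int j) w * a (pair_decode l))
    sums h ((T ^^ j) (Y w))"
  using AE_inactive AE_pair_summable[of "\<lambda>i. (fst i, snd i - int j)", simplified]
proof eventually_elim
  case (elim w)
  have "summable (\<lambda>m. X m w)"
    using summable_norm_X(1)[OF elim(1)] by (rule summable_norm_cancel)
  then have "h ((T ^^ j) (Y w)) = (\<Sum>m. h (X m (translate j w)))"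
    unfolding Y_def X_translate
    using bounded_linear.suminf[OF bounded_linear_compose[OF h_linear bounded_linear_funpow[of j]]] by blast
  moreover have "(\<lambda>l. (\<lambda>i. xi (fst i, snd i - int j) w * a i) (pair_decode l)) sums (\<Sum>m. h (X m (translate j w)))"
  proof (rule suminf_pair_decode)
    show "((\<lambda>k. xi (fst (m, k), snd (m, k) - int j) w * a (m, k)) has_sum h (X m (translate j w))) UNIV" for m
      using h_X_has_sum[of m "translate j w"] by (simp add: xi_translate)
  qed (use elim(2) in simp)
  ultimately show ?case by simp
qed

lemma AE_G_sums:
  "AE w in W. (\<lambda>l. xi (fst (pair_decode l), - int j) w * a (pair_decode l)) sums G j w"
  using AE_pair_summable[of "\<lambda>i. (fst i, - int j)", simplified]
proof eventually_elim
  case (elim w)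
  have "(\<lambda>l. (\<lambda>i. xi (fst i, - int j) w * a i) (pair_decode l)) sums (\<Sum>m. xi (m, - int j) w * A m)"
  proof (rule suminf_pair_decode)
    show "((\<lambda>k. xi (fst (m, k), - int j) w * a (m, k)) has_sum xi (m, - int j) w * A m) UNIV" for m
      using has_sum_cmult_right[OF a_has_sum[of m]] by simp
  qed (use elim in simp)
  then show ?case by (simp add: G_def)
qed

text \<open>The coefficient of \<open>a i\<close> in the difference between the Birkhoff sum and the
  sum of the \<open>G j\<close>.\<close>

definition b :: "nat \<Rightarrow> nat \<times> int \<Rightarrow> (nat \<times> int \<Rightarrow> bool \<times> bool) \<Rightarrow> real" where
  "b n i w = (\<Sum>j<n. xi (fst i, snd i - int j) w - xi (fst i, - int j) w)"

lemma integrable_b: "integrable W (b n i)"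
  unfolding b_def [abs_def] by (intro Bochner_Integration.integrable_sum Bochner_Integration.integrable_diff integrable_xi)

text \<open>Two competing bounds. The telescoping one does not grow with \<open>n\<close>, so each
  single term is negligible against sqrt n; the one from orthogonality grows like sqrt n but is
  summable over all indices when weighted by the absolute values of \<open>a\<close>.\<close>

lemma expectation_abs_b_le:
  "(\<integral>w. \<bar>b n i w\<bar> \<partial>W) \<le> min (2 * \<bar>real_of_int (snd i)\<bar>) (2 * sqrt (real n) * sqrt (p (fst i)))"
proof (rule min.boundedI)
  have "\<bar>b n i w\<bar> \<le> 2 * \<bar>real_of_int (snd i)\<bar>" for w
    unfolding b_def using abs_sum_shift_diff_le[of "\<lambda>k. xi (fst i, k) w"] abs_xi_le by simp
  then have "(\<integral>w. \<bar>b n i w\<bar> \<partial>W) \<le> (\<integral>w. 2 * \<bar>real_of_int (snd i)\<bar> \<partial>W)"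
    by (intro integral_mono) (auto intro: integrable_b)
  then show "(\<integral>w. \<bar>b n i w\<bar> \<partial>W) \<le> 2 * \<bar>real_of_int (snd i)\<bar>"
    using P.prob_space by simp
  have orbit: "(\<integral>w. \<bar>\<Sum>j<n. xi (fst i, k - int j) w\<bar> \<partial>W) \<le> sqrt (real n) * sqrt (p (fst i))" for k
  proof -
    have inj: "inj_on (\<lambda>j. (fst i, k - int j)) {..<n}" by (auto simp: inj_on_def)
    have "(\<integral>w. \<bar>\<Sum>i\<in>(\<lambda>j. (fst i, k - int j)) ` {..<n}. xi i w\<bar> \<partial>W)
        \<le> sqrt (\<Sum>i\<in>(\<lambda>j. (fst i, k - int j)) ` {..<n}. p (fst i))"
      by (rule expectation_abs_sum_xi_le) simp
    then show ?thesis
      using inj by (simp add: sum.reindex real_sqrt_mult)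
  qed
  have int: "integrable W (\<lambda>w. \<bar>\<Sum>j<n. xi (fst i, k - int j) w\<bar>)" for k
    by (intro integrable_abs Bochner_Integration.integrable_sum integrable_xi)
  have "(\<integral>w. \<bar>b n i w\<bar> \<partial>W)
      \<le> (\<integral>w. \<bar>\<Sum>j<n. xi (fst i, snd i - int j) w\<bar> + \<bar>\<Sum>j<n. xi (fst i, 0 - int j) w\<bar> \<partial>W)"
  proof (rule integral_mono)
    show "\<bar>b n i w\<bar> \<le> \<bar>\<Sum>j<n. xi (fst i, snd i - int j) w\<bar> + \<bar>\<Sum>j<n. xi (fst i, 0 - int j) w\<bar>" for w
      unfolding b_def sum_subtractf using abs_triangle_ineq4 by simp
  qed (rule integrable_abs[OF integrable_b] Bochner_Integration.integrable_add[OF int int])+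
  also have "\<dots> = (\<integral>w. \<bar>\<Sum>j<n. xi (fst i, snd i - int j) w\<bar> \<partial>W) + (\<integral>w. \<bar>\<Sum>j<n. xi (fst i, 0 - int j) w\<bar> \<partial>W)"
    by (rule Bochner_Integration.integral_add[OF int int])
  also have "\<dots> \<le> 2 * sqrt (real n) * sqrt (p (fst i))"
    using orbit[of "snd i"] orbit[of 0] by simp
  finally show "(\<integral>w. \<bar>b n i w\<bar> \<partial>W) \<le> 2 * sqrt (real n) * sqrt (p (fst i))" .
qed

definition R :: "nat \<Rightarrow> (nat \<times> int \<Rightarrow> bool \<times> bool) \<Rightarrow> real" where
  "R n w = (\<Sum>l. b n (pair_decode l) w * a (pair_decode l))"

lemma AE_R: "AE w in W. (\<Sum>j<n. h ((T ^^ j) (Y w))) = (\<Sum>j<n. G j w) + R n w"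
proof -
  have "AE w in W. \<forall>j. (\<lambda>l. xi (fst (pair_decode l), snd (pair_decode l) - int j) w * a (pair_decode l))
    sums h ((T ^^ j) (Y w)) \<and> (\<lambda>l. xi (fst (pair_decode l), - int j) w * a (pair_decode l)) sums G j w"
    unfolding AE_all_countable
  proof
    show "AE w in W. (\<lambda>l. xi (fst (pair_decode l), snd (pair_decode l) - int j) w * a (pair_decode l))
        sums h ((T ^^ j) (Y w)) \<and> (\<lambda>l. xi (fst (pair_decode l), - int j) w * a (pair_decode l)) sums G j w" for j
      using AE_orbit_sums[of j] AE_G_sums[of j] by eventually_elim simp
  qed
  then show ?thesis
  proof eventually_elim
    case (elim w)
    have "(\<lambda>l. \<Sum>j<n. xi (fst (pair_decode l), snd (pair_decode l) - int j) w * a (pair_decode l)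
        - xi (fst (pair_decode l), - int j) w * a (pair_decode l)) sums (\<Sum>j<n. h ((T ^^ j) (Y w)) - G j w)"
      using elim by (intro sums_sum sums_diff) auto
    then have "R n w = (\<Sum>j<n. h ((T ^^ j) (Y w)) - G j w)"
      unfolding R_def b_def by (simp add: sums_iff sum_distrib_right left_diff_distrib)
    then show ?case by (simp add: sum_subtractf)
  qed
qed

lemma R_bound:
  "integrable W (R n)"
  "(\<integral>w. \<bar>R n w\<bar> \<partial>W) \<le> (\<Sum>l. min (2 * \<bar>real_of_int (snd (pair_decode l))\<bar>)
      (2 * sqrt (real n) * sqrt (p (fst (pair_decode l)))) * \<bar>a (pair_decode l)\<bar>)"
proof -
  let ?f = "\<lambda>l w. b n (pair_decode l) w * a (pair_decode l)"
  let ?B = "\<lambda>l. min (2 * \<bar>real_of_int (snd (pair_decode l))\<bar>)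
      (2 * sqrt (real n) * sqrt (p (fst (pair_decode l)))) * \<bar>a (pair_decode l)\<bar>"
  have f: "integrable W (?f l)" for l by (intro integrable_mult_left integrable_b)
  have le: "(\<integral>w. \<bar>?f l w\<bar> \<partial>W) \<le> ?B l" for l
    unfolding abs_mult integral_mult_left_zero
    by (intro mult_right_mono expectation_abs_b_le abs_ge_zero)
  have sB: "summable ?B"
  proof (rule summable_comparison_test'[of _ 0])
    show "summable (\<lambda>l. 2 * sqrt (real n) * (sqrt (p (fst (pair_decode l))) * \<bar>a (pair_decode l)\<bar>))"
      by (intro summable_mult pair_summable)
    show "norm (?B l) \<le> 2 * sqrt (real n) * (sqrt (p (fst (pair_decode l))) * \<bar>a (pair_decode l)\<bar>)" for l
      using p_pos[of "fst (pair_decode l)"]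
      by (auto simp: abs_mult mult.assoc[symmetric] intro!: mult_right_mono)
  qed
  have s: "summable (\<lambda>l. \<integral>w. \<bar>?f l w\<bar> \<partial>W)"
    by (rule summable_comparison_test'[OF sB, of 0]) (simp add: le)
  show "integrable W (R n)"
    unfolding R_def[abs_def] by (rule series_L1(2)[OF f s])
  have "(\<integral>w. \<bar>R n w\<bar> \<partial>W) \<le> (\<Sum>l. \<integral>w. \<bar>?f l w\<bar> \<partial>W)"
    unfolding R_def by (rule series_L1(4)[OF f s])
  also have "\<dots> \<le> suminf ?B" by (intro suminf_le le s sB)
  finally show "(\<integral>w. \<bar>R n w\<bar> \<partial>W) \<le> suminf ?B" .
qed

text \<open>Tannery's theorem: after division by sqrt n each term tends to 0 by the first entry of
  the minimum, while the second entry is a summable majorant independent of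
  \<open>n\<close>.\<close>

lemma R_negligible: "(\<lambda>n. (\<integral>w. \<bar>R n w\<bar> \<partial>W) / sqrt (real n)) \<longlonglongrightarrow> 0"
proof -
  let ?k = "\<lambda>l. \<bar>real_of_int (snd (pair_decode l))\<bar>" and ?q = "\<lambda>l. sqrt (p (fst (pair_decode l)))"
  define c where "c l n = min (2 * ?k l / sqrt (real n)) (2 * ?q l) * \<bar>a (pair_decode l)\<bar>" for l n
  have q: "?q l \<ge> 0" for l using p_pos[of "fst (pair_decode l)"] by simp
  have "(\<lambda>n. \<Sum>l. c l n) \<longlonglongrightarrow> (\<Sum>l. 0)"
  proof (rule tannerys_theorem[THEN conjunct2, THEN conjunct2])
    show "(\<lambda>n. c l n) \<longlonglongrightarrow> 0" for l
    proof (rule tendsto_sandwich[OF _ _ tendsto_const])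
      have "(\<lambda>n. 2 * ?k l * (1 / sqrt (real n)) * \<bar>a (pair_decode l)\<bar>) \<longlonglongrightarrow> 2 * ?k l * 0 * \<bar>a (pair_decode l)\<bar>"
        by (intro tendsto_intros tendsto_divide_0[OF tendsto_const] filterlim_at_top_imp_at_infinity
            filterlim_compose[OF sqrt_at_top] filterlim_real_sequentially)
      then show "(\<lambda>n. 2 * ?k l / sqrt (real n) * \<bar>a (pair_decode l)\<bar>) \<longlonglongrightarrow> 0" by simp
      show "\<forall>\<^sub>F n in sequentially. 0 \<le> c l n" using q[of l] by (simp add: c_def)
      show "\<forall>\<^sub>F n in sequentially. c l n \<le> 2 * ?k l / sqrt (real n) * \<bar>a (pair_decode l)\<bar>"
        unfolding c_def by (intro always_eventually allI mult_right_mono) auto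
    qed
    show "\<forall>\<^sub>F (l, n) in sequentially \<times>\<^sub>F sequentially. norm (c l n) \<le> 2 * (?q l * \<bar>a (pair_decode l)\<bar>)"
    proof (intro always_eventually allI, clarify)
      fix l n
      have "0 \<le> c l n" using q[of l] by (simp add: c_def)
      moreover have "c l n \<le> 2 * ?q l * \<bar>a (pair_decode l)\<bar>"
        unfolding c_def by (intro mult_right_mono) auto
      ultimately show "norm (c l n) \<le> 2 * (?q l * \<bar>a (pair_decode l)\<bar>)" by simp
    qed
    show "summable (\<lambda>l. 2 * (?q l * \<bar>a (pair_decode l)\<bar>))" by (intro summable_mult pair_summable)
  qed simp
  then have lim: "(\<lambda>n. \<Sum>l. c l n) \<longlonglongrightarrow> 0" by simp
  show ?thesis
  proof (rule tendsto_sandwich[OF _ _ tendsto_const lim])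
    show "\<forall>\<^sub>F n in sequentially. 0 \<le> (\<integral>w. \<bar>R n w\<bar> \<partial>W) / sqrt (real n)" by simp
    show "\<forall>\<^sub>F n in sequentially. (\<integral>w. \<bar>R n w\<bar> \<partial>W) / sqrt (real n) \<le> (\<Sum>l. c l n)"
      using eventually_gt_at_top[of 0]
    proof eventually_elim
      case (elim n)
      then have n: "sqrt (real n) > 0" by simp
      have s: "summable (\<lambda>l. c l n)"
      proof (rule summable_comparison_test'[of _ 0])
        show "summable (\<lambda>l. 2 * (?q l * \<bar>a (pair_decode l)\<bar>))" by (intro summable_mult pair_summable)
        show "norm (c l n) \<le> 2 * (?q l * \<bar>a (pair_decode l)\<bar>)" for l
        proof -
          have "0 \<le> c l n" using q[of l] by (simp add: c_def)
          moreover have "c l n \<le> 2 * ?q l * \<bar>a (pair_decode l)\<bar>"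
            unfolding c_def by (intro mult_right_mono) auto
          ultimately show ?thesis by simp
        qed
      qed
      have "(\<integral>w. \<bar>R n w\<bar> \<partial>W) \<le> (\<Sum>l. sqrt (real n) * c l n)"
      proof -
        have "min (2 * ?k l) (2 * sqrt (real n) * ?q l) * \<bar>a (pair_decode l)\<bar> = sqrt (real n) * c l n" for l
          unfolding c_def min_def using n by (simp add: field_simps)
        then show ?thesis using R_bound(2)[of n] by simp
      qed
      also have "\<dots> = sqrt (real n) * (\<Sum>l. c l n)" by (rule suminf_mult[OF s])
      finally show ?case using n by (simp add: pos_divide_le_eq mult.commute)
    qed
  qed
qed

end

section \<open>The central limit theorem for the law\<close>

context orbit_functional
begin

text \<open>Input for the exponential moment lemma with one coordinate per block. It yields an
  integrable exponential of the variable that dominates \<open>G j\<close>, hence a second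
  moment.\<close>

lemma summable_column: "summable (\<lambda>m. P.prob {w. xi (m, - int j) w \<noteq> 0} * exp (\<Sum>n\<le>m. D n))"
proof (rule summable_comparison_test'[of "\<lambda>m. (1/4) ^ Suc m" 0])
  show "summable (\<lambda>m. (1/4 :: real) ^ Suc m)" by (simp add: summable_Suc_iff summable_geometric)
  fix m
  let ?S = "\<Sum>n\<le>m. D n"
  have S: "?S \<ge> 0" by (intro sum_nonneg D_nonneg)
  have "p m * exp ?S \<le> exp (- 2 * ?S) * (1/4) ^ Suc m * exp ?S"
    by (intro mult_right_mono p_le) simp
  also have "\<dots> = exp (- ?S) * (1/4) ^ Suc m"
    by (simp add: exp_add[symmetric])
  also have "\<dots> \<le> 1 * (1/4) ^ Suc m"
    using S by (intro mult_right_mono) auto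
  finally show "norm (P.prob {w. xi (m, - int j) w \<noteq> 0} * exp ?S) \<le> (1/4) ^ Suc m"
    using p_pos[of m] by (simp add: prob_xi_nonzero abs_mult)
qed

lemma AE_column: "AE w in W. eventually (\<lambda>m. w \<notin> {w. xi (m, - int j) w \<noteq> 0}) sequentially"
  by (rule P.exp_sum_indicator(1)[OF _ _ summable_column]) (simp_all add: D_nonneg)

lemma integrable_exp_column:
  "integrable W (\<lambda>w. exp (\<Sum>m. D m * indicator {w. xi (m, - int j) w \<noteq> 0} w))"
  by (rule P.exp_sum_indicator(2)[OF _ _ summable_column]) (simp_all add: D_nonneg)

lemma measurable_G [measurable]: "G j \<in> borel_measurable W"
  unfolding G_def [abs_def] by measurable

lemma integrable_G_square: "integrable W (\<lambda>w. (G j w)\<^sup>2)"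
proof (rule Bochner_Integration.integrable_bound)
  let ?V = "\<lambda>w. \<Sum>m. D m * indicator {w. xi (m, - int j) w \<noteq> 0} w"
  show "integrable W (\<lambda>w. 2 * K\<^sup>2 * exp (?V w))"
    by (intro integrable_mult_right integrable_exp_column)
  show "AE w in W. norm ((G j w)\<^sup>2) \<le> norm (2 * K\<^sup>2 * exp (?V w))"
    using AE_column[of j]
  proof eventually_elim
    case (elim w)
    let ?i = "\<lambda>m. D m * indicator {w. xi (m, - int j) w \<noteq> 0} w"
    from elim have "eventually (\<lambda>m. norm (?i m) \<le> 0) sequentially"
      by eventually_elim simp
    then have s: "summable ?i" by (rule summable_comparison_test_ev[OF _ summable_zero])
    have le: "norm (xi (m, - int j) w * A m) \<le> K * ?i m" for m
    proof (cases "xi (m, - int j) w = 0")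
      case False
      have "\<bar>xi (m, - int j) w\<bar> * \<bar>A m\<bar> \<le> 1 * (K * D m)"
        by (intro mult_mono abs_xi_le abs_A_le) auto
      then show ?thesis using False by (simp add: abs_mult)
    qed simp
    have "norm (G j w) \<le> (\<Sum>m. K * ?i m)"
      unfolding G_def using le by (intro norm_suminf_le summable_mult s)
    also have "\<dots> = K * ?V w" by (rule suminf_mult[OF s])
    finally have "\<bar>G j w\<bar>\<^sup>2 \<le> (K * ?V w)\<^sup>2" by (intro power_mono) auto
    \<comment> \<open>The quadratic Taylor bound for \<open>exp\<close> on nonnegative arguments
      trades the second moment for the exponential one.\<close>
    moreover have "(?V w)\<^sup>2 \<le> 2 * exp (?V w)"
    proof -
      have "0 \<le> ?V w" by (intro suminf_nonneg s mult_nonneg_nonneg D_nonneg) simp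
      then show ?thesis using exp_lower_Taylor_quadratic[of "?V w"] by simp
    qed
    then have "K\<^sup>2 * (?V w)\<^sup>2 \<le> K\<^sup>2 * (2 * exp (?V w))" by (rule mult_left_mono) simp
    ultimately show ?case by (simp add: power_mult_distrib abs_mult)
  qed
qed simp

lemma expectation_G: "(\<integral>w. G j w \<partial>W) = 0"
proof -
  have "(\<integral>w. G j w \<partial>W) = (\<Sum>m. \<integral>w. xi (m, - int j) w * A m \<partial>W)"
    unfolding G_def
  proof (rule series_L1(3))
    show "integrable W (\<lambda>w. xi (m, - int j) w * A m)" for m
      by (intro integrable_mult_left integrable_xi)
    show "summable (\<lambda>m. \<integral>w. \<bar>xi (m, - int j) w * A m\<bar> \<partial>W)"
    proof (rule summable_comparison_test'[OF summable_half_power, of 0])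
      fix m
      have "p m * \<bar>A m\<bar> \<le> sqrt (p m) * (K * D m)"
        using p_pos[of m] by (intro mult_mono p_le_sqrt abs_A_le) auto
      also have "\<dots> \<le> K * (1/2) ^ Suc m"
        using mult_left_mono[OF sqrt_p_D_le K_nonneg, of m] by (simp add: mult_ac)
      finally show "norm (\<integral>w. \<bar>xi (m, - int j) w * A m\<bar> \<partial>W) \<le> K * (1/2) ^ Suc m"
        using p_pos[of m] by (simp add: abs_mult expectation_abs_xi)
    qed
  qed
  then show ?thesis by (simp add: expectation_xi)
qed

lemma G_translate: "G j w = G 0 (translate j w)"
  by (simp add: G_def xi_translate)

lemma distr_G: "distr W borel (G j) = distr W borel (G 0)"
proof -
  have "distr W borel (G j) = distr W borel (G 0 \<circ> translate j)"
    by (rule arg_cong[where f="distr W borel"]) (auto simp: G_translate[of j])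
  also have "\<dots> = distr (distr W W (translate j)) borel (G 0)"
    by (rule distr_distr[symmetric]) simp_all
  finally show ?thesis by (simp add: distr_translate)
qed

lemma expectation_G_square: "(\<integral>w. (G j w)\<^sup>2 \<partial>W) = (\<integral>w. (G 0 w)\<^sup>2 \<partial>W)"
proof -
  have "(\<integral>w. (G j w)\<^sup>2 \<partial>W) = integral\<^sup>L (distr W borel (G j)) (\<lambda>x. x\<^sup>2)"
    by (simp add: integral_distr)
  then show ?thesis by (simp add: distr_G[of j] integral_distr)
qed

text \<open>\<open>G j\<close> depends only on the coordinates at position \<open>- j\<close>, and
  these sets are disjoint for distinct \<open>j\<close>.\<close>

lemma indep_G: "P.indep_vars (\<lambda>_. borel) G UNIV"
proof -
  let ?C = "\<lambda>j. (UNIV :: nat set) \<times> {- int j}" and ?N = "\<lambda>i :: nat \<times> int. measure_pmf (coin (p (fst i)))"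
  let ?g = "\<lambda>j v. \<Sum>m. coin_sign (v (m, - int j)) * A m"
  have "P.indep_vars (\<lambda>j. PiM (?C j) ?N) (\<lambda>j w. restrict (\<lambda>i. w i) (?C j)) UNIV"
    by (rule P.indep_vars_restrict[OF indep_coordinates]) (auto simp: disjoint_family_on_def)
  then have "P.indep_vars (\<lambda>_. borel) (\<lambda>j w. ?g j (restrict (\<lambda>i. w i) (?C j))) UNIV"
  proof (rule P.indep_vars_compose2)
    fix j
    have "(\<lambda>v. coin_sign (v (m, - int j))) \<in> borel_measurable (PiM (?C j) ?N)" for m
      by (rule measurable_compose[OF measurable_component_singleton[of "(m, - int j)"]]) simp_all
    then show "?g j \<in> borel_measurable (PiM (?C j) ?N)" by measurable
  qed
  moreover have "(\<lambda>j w. ?g j (restrict (\<lambda>i. w i) (?C j))) = G"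
    by (simp add: fun_eq_iff G_def xi_def)
  ultimately show ?thesis by simp
qed

definition \<sigma> :: real where
  "\<sigma> = sqrt (\<integral>w. (G 0 w)\<^sup>2 \<partial>W)"

lemma sigma_nonneg: "\<sigma> \<ge> 0"
  unfolding \<sigma>_def by (intro real_sqrt_ge_zero integral_nonneg_AE) auto

lemma sigma_square: "\<sigma>\<^sup>2 = (\<integral>w. (G 0 w)\<^sup>2 \<partial>W)"
  unfolding \<sigma>_def by (intro real_sqrt_pow2 integral_nonneg_AE) auto

text \<open>Characteristic functions treat the degenerate case on the same footing: for
  \<open>\<sigma> = 0\<close> every \<open>G j\<close> vanishes almost everywhere. Otherwise the
  classical theorem normalises by \<sigma>, and evaluation at \<open>\<sigma> * t\<close> undoes
  this.\<close>

lemma char_sum_G: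
  "(\<lambda>n. char (distr W borel (\<lambda>w. (\<Sum>j<n. G j w) / sqrt (real n))) t)
    \<longlonglongrightarrow> exp (- ((\<sigma> * t)\<^sup>2) / 2)"
proof (cases "\<sigma> = 0")
  case True
  have "AE w in W. G j w = 0" for j
  proof -
    have "(\<integral>w. (G j w)\<^sup>2 \<partial>W) = 0"
      using expectation_G_square[of j] sigma_square True by simp
    then have "AE w in W. (G j w)\<^sup>2 = 0"
      by (subst (asm) integral_nonneg_eq_0_iff_AE[OF integrable_G_square]) auto
    then show ?thesis by simp
  qed
  then have zero: "AE w in W. \<forall>j. G j w = 0" by (simp add: AE_all_countable)
  have "char (distr W borel (\<lambda>w. (\<Sum>j<n. G j w) / sqrt (real n))) t = 1" for n
  proof -
    have "char (distr W borel (\<lambda>w. (\<Sum>j<n. G j w) / sqrt (real n))) t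
        = (CLINT w|W. iexp (t * ((\<Sum>j<n. G j w) / sqrt (real n))))"
      by (rule char_distr) simp
    also have "\<dots> = (CLINT w|W. 1)"
    proof (rule integral_cong_AE)
      show "AE w in W. iexp (t * ((\<Sum>j<n. G j w) / sqrt (real n))) = 1"
        using zero by eventually_elim simp
    qed simp_all
    finally show ?thesis using P.prob_space by simp
  qed
  then show ?thesis using True by simp
next
  case False
  then have pos: "\<sigma> > 0" using sigma_nonneg by simp
  let ?M = "\<lambda>n. distr W borel (\<lambda>w. (\<Sum>j<n. G j w) / sqrt (real n * \<sigma>\<^sup>2))"
  have "weak_conv_m ?M std_normal_distribution"
  proof (rule P.central_limit_theorem_zero_mean)
    show "P.variance (G n) = \<sigma>\<^sup>2" for n
      by (simp add: expectation_G expectation_G_square[of n] sigma_square)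
  qed (fact pos indep_G expectation_G integrable_G_square distr_G)+
  then have lim: "(\<lambda>n. char (?M n) (\<sigma> * t)) \<longlonglongrightarrow> char std_normal_distribution (\<sigma> * t)"
    by (intro levy_continuity1) (auto intro: real_dist_normal_dist)
  have "char (distr W borel (\<lambda>w. (\<Sum>j<n. G j w) / sqrt (real n))) t = char (?M n) (\<sigma> * t)" for n
  proof -
    have "\<sigma> * t * (x / sqrt (real n * \<sigma>\<^sup>2)) = t * (x / sqrt (real n))" for x
      using pos by (simp add: real_sqrt_mult)
    then show ?thesis by (subst (1 2) char_distr) simp_all
  qed
  with lim show ?thesis by (simp add: char_std_normal_distribution)
qed

lemma measurable_functional: "(\<lambda>y. h ((T ^^ j) y)) \<in> borel_measurable borel"
  by (rule borel_measurable_continuous_onI)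
    (rule bounded_linear.continuous_on[OF bounded_linear_compose[OF h_linear bounded_linear_funpow] continuous_on_id])

lemma measurable_birkhoff:
  "(\<lambda>y. (\<Sum>j<n. h ((T ^^ j) y)) / sqrt (real n)) \<in> borel_measurable borel"
  by (intro borel_measurable_divide borel_measurable_sum measurable_functional borel_measurable_const)

lemma measurable_birkhoff_Y:
  "(\<lambda>w. (\<Sum>j<n. h ((T ^^ j) (Y w))) / sqrt (real n)) \<in> borel_measurable W"
  by (rule measurable_compose[OF measurable_Y measurable_birkhoff])

text \<open>Since \<open>iexp\<close> is 1-Lipschitz, an error that is small in L^1 moves the
  characteristic function at \<open>t\<close> by at most \<open>\<bar>t\<bar>\<close> times its L^1
  norm.\<close>

lemma char_birkhoff_sum:
  "(\<lambda>n. char (distr law borel (\<lambda>y. (\<Sum>j<n. h ((T ^^ j) y)) / sqrt (real n))) t)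
    \<longlonglongrightarrow> exp (- ((\<sigma> * t)\<^sup>2) / 2)"
proof -
  let ?S = "\<lambda>n w. (\<Sum>j<n. h ((T ^^ j) (Y w))) / sqrt (real n)"
  let ?Z = "\<lambda>n w. (\<Sum>j<n. G j w) / sqrt (real n)"
  have S_char: "char (distr law borel (\<lambda>y. (\<Sum>j<n. h ((T ^^ j) y)) / sqrt (real n))) t
      = (CLINT w|W. iexp (t * ?S n w))" for n
  proof -
    have "distr law borel (\<lambda>y. (\<Sum>j<n. h ((T ^^ j) y)) / sqrt (real n)) = distr W borel (?S n)"
      unfolding law_def distr_distr[OF measurable_birkhoff measurable_Y] o_def ..
    then show ?thesis
      by (simp only: char_distr[OF measurable_birkhoff_Y])
  qed
  have Z_char: "char (distr W borel (?Z n)) t = (CLINT w|W. iexp (t * ?Z n w))" for n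
    by (rule char_distr) simp
  have int_iexp: "integrable W (\<lambda>w. iexp (t * f w))" if [measurable]: "f \<in> borel_measurable W" for f :: "_ \<Rightarrow> real"
    by (rule P.integrable_iexp) simp_all
  have diff: "cmod ((CLINT w|W. iexp (t * ?S n w)) - (CLINT w|W. iexp (t * ?Z n w)))
      \<le> \<bar>t\<bar> * ((\<integral>w. \<bar>R n w\<bar> \<partial>W) / sqrt (real n))" for n
  proof -
    have int: "integrable W (\<lambda>w. iexp (t * ?S n w))" "integrable W (\<lambda>w. iexp (t * ?Z n w))"
      by (rule int_iexp[OF measurable_birkhoff_Y], rule int_iexp, simp)
    have "cmod ((CLINT w|W. iexp (t * ?S n w)) - (CLINT w|W. iexp (t * ?Z n w)))
        = cmod (CLINT w|W. iexp (t * ?S n w) - iexp (t * ?Z n w))"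
      by (simp only: Bochner_Integration.integral_diff[OF int])
    also have "\<dots> \<le> (\<integral>w. cmod (iexp (t * ?S n w) - iexp (t * ?Z n w)) \<partial>W)"
      by (rule integral_norm_bound)
    also have "\<dots> \<le> (\<integral>w. \<bar>t\<bar> * (\<bar>R n w\<bar> / sqrt (real n)) \<partial>W)"
    proof (rule integral_mono_AE)
      show "integrable W (\<lambda>w. cmod (iexp (t * ?S n w) - iexp (t * ?Z n w)))"
        using int by (intro integrable_norm Bochner_Integration.integrable_diff)
      show "integrable W (\<lambda>w. \<bar>t\<bar> * (\<bar>R n w\<bar> / sqrt (real n)))"
        using R_bound(1)[of n] by (intro integrable_mult_right integrable_divide integrable_abs)
      show "AE w in W. cmod (iexp (t * ?S n w) - iexp (t * ?Z n w)) \<le> \<bar>t\<bar> * (\<bar>R n w\<bar> / sqrt (real n))"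
        using AE_R[of n]
      proof eventually_elim
        case (elim w)
        have "t * ?S n w - t * ?Z n w = t * (R n w / sqrt (real n))"
          unfolding elim by (simp add: add_divide_distrib algebra_simps)
        then show ?case
          using cmod_iexp_diff_le[of "t * ?S n w" "t * ?Z n w"] by (simp add: abs_mult)
      qed
    qed
    also have "\<dots> = \<bar>t\<bar> * ((\<integral>w. \<bar>R n w\<bar> \<partial>W) / sqrt (real n))" by simp
    finally show ?thesis .
  qed
  have null: "(\<lambda>n. \<bar>t\<bar> * ((\<integral>w. \<bar>R n w\<bar> \<partial>W) / sqrt (real n))) \<longlonglongrightarrow> 0"
    using tendsto_mult_left[OF R_negligible, of "\<bar>t\<bar>"] by (simp only: mult_zero_right)
  have "(\<lambda>n. (CLINT w|W. iexp (t * ?S n w)) - (CLINT w|W. iexp (t * ?Z n w))) \<longlonglongrightarrow> 0"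
    by (rule Lim_null_comparison[OF always_eventually[OF allI[OF diff]] null])
  from tendsto_add[OF this char_sum_G[of t, unfolded Z_char]]
  show ?thesis by (simp only: S_char diff_add_cancel add_0_left)
qed

lemma central_limit_theorem_law:
  "weak_conv_m (\<lambda>n. distr law borel (\<lambda>y. (\<Sum>j<n. h ((T ^^ j) y)) / sqrt (real n)))
    (if \<sigma> = 0 then return borel 0 else density lborel (normal_density 0 \<sigma>))"
proof (rule levy_continuity)
  interpret law: prob_space law by (rule prob_space_law)
  show "real_distribution (distr law borel (\<lambda>y. (\<Sum>j<n. h ((T ^^ j) y)) / sqrt (real n)))" for n
    using measurable_birkhoff by (intro law.real_distribution_distr) (simp add: law_def)
  show "real_distribution (if \<sigma> = 0 then return borel 0 else density lborel (normal_density 0 \<sigma>))"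
    using sigma_nonneg real_distribution_normal[of \<sigma> 0]
    by (auto simp: real_distribution_def real_distribution_axioms_def prob_space_return)
  have "char (if \<sigma> = 0 then return borel 0 else density lborel (normal_density 0 \<sigma>)) t = exp (- ((\<sigma> * t)\<^sup>2) / 2)" for t
    using sigma_nonneg char_normal[of \<sigma> t] by (auto simp: char_def integral_return)
  then show "(\<lambda>n. char (distr law borel (\<lambda>y. (\<Sum>j<n. h ((T ^^ j) y)) / sqrt (real n))) t)
      \<longlonglongrightarrow> char (if \<sigma> = 0 then return borel 0 else density lborel (normal_density 0 \<sigma>)) t" for t
    using char_birkhoff_sum[of t] by simp
qed

end

section \<open>Growth and measurability of analytic functions\<close>

lemma multilinear_form_linear:
  assumes "multilinear_form k L" "i < k" "length us = i" "length vs = k - Suc i"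
  shows "linear (\<lambda>h. L (us @ h # vs))"
  using assms unfolding multilinear_form_def by blast

lemma replicate_Suc_split:
  assumes "j < k"
  shows "replicate (Suc j) y @ replicate (k - Suc j) x = replicate j y @ y # replicate (k - Suc j) x"
    and "replicate j y @ replicate (k - j) x = replicate j y @ x # replicate (k - Suc j) x"
proof -
  show "replicate (Suc j) y @ replicate (k - Suc j) x = replicate j y @ y # replicate (k - Suc j) x"
    by (simp add: replicate_app_Cons_same)
  have "k - j = Suc (k - Suc j)" using assms by simp
  then show "replicate j y @ replicate (k - j) x = replicate j y @ x # replicate (k - Suc j) x" by simp
qed

text \<open>Changing \<open>x\<close> into \<open>y\<close> one slot at a time writes the difference
  as a telescoping sum, and linearity in the changed slot gives each summand a factor
  \<open>norm (y - x)\<close>.\<close>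

lemma multilinear_form_continuous:
  assumes L: "multilinear_form k L"
  shows "continuous_on UNIV (\<lambda>x. L (replicate k x))"
proof -
  obtain C where C: "\<And>hs. length hs = k \<Longrightarrow> \<bar>L hs\<bar> \<le> C * prod_list (map norm hs)"
    using L unfolding multilinear_form_def by blast
  have bound: "\<bar>L (replicate k y) - L (replicate k x)\<bar>
      \<le> (\<Sum>j<k. C * (norm y ^ j * (norm (y - x) * norm x ^ (k - Suc j))))" for x y
  proof -
    let ?r = "\<lambda>j. L (replicate j y @ replicate (k - j) x)"
    have "\<bar>?r (Suc j) - ?r j\<bar> \<le> C * (norm y ^ j * (norm (y - x) * norm x ^ (k - Suc j)))" if j: "j < k" for j
    proof -
      have "linear (\<lambda>h. L (replicate j y @ h # replicate (k - Suc j) x))"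
        using j by (intro multilinear_form_linear[OF L]) auto
      from linear_diff[OF this, of y x]
      have "?r (Suc j) - ?r j = L (replicate j y @ (y - x) # replicate (k - Suc j) x)"
        unfolding replicate_Suc_split[OF j] by simp
      then show ?thesis
        using C[of "replicate j y @ (y - x) # replicate (k - Suc j) x"] j by simp
    qed
    then have "\<bar>\<Sum>j<k. ?r (Suc j) - ?r j\<bar> \<le> (\<Sum>j<k. C * (norm y ^ j * (norm (y - x) * norm x ^ (k - Suc j))))"
      by (intro order_trans[OF sum_abs] sum_mono) auto
    moreover have "(\<Sum>j<k. ?r (Suc j) - ?r j) = ?r k - ?r 0"
      by (rule sum_lessThan_telescope)
    ultimately have "\<bar>?r k - ?r 0\<bar> \<le> (\<Sum>j<k. C * (norm y ^ j * (norm (y - x) * norm x ^ (k - Suc j))))"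
      by (simp only:)
    then show ?thesis by simp
  qed
  show ?thesis
  proof (intro continuous_at_imp_continuous_on ballI)
    fix x :: 'a
    have "((\<lambda>y. \<Sum>j<k. C * (norm y ^ j * (norm (y - x) * norm x ^ (k - Suc j)))) \<longlongrightarrow>
        (\<Sum>j<k. C * (norm x ^ j * (norm (x - x) * norm x ^ (k - Suc j))))) (at x)"
      by (intro tendsto_intros)
    then have lim: "((\<lambda>y. \<Sum>j<k. C * (norm y ^ j * (norm (y - x) * norm x ^ (k - Suc j)))) \<longlongrightarrow> 0) (at x)"
      by simp
    have "((\<lambda>y. L (replicate k y) - L (replicate k x)) \<longlongrightarrow> 0) (at x)"
      by (rule Lim_null_comparison[OF always_eventually[OF allI[OF bound[folded real_norm_def]]] lim])
    then show "isCont (\<lambda>x. L (replicate k x)) x"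
      unfolding isCont_def by (rule LIM_zero_cancel)
  qed
qed

lemma multilinear_form_homogeneous:
  assumes L: "multilinear_form k L"
  shows "L (replicate k (c *\<^sub>R x)) = c ^ k * L (replicate k x)"
proof -
  have "L (replicate j (c *\<^sub>R x) @ replicate (k - j) x) = c ^ j * L (replicate k x)" if "j \<le> k" for j
    using that
  proof (induction j)
    case (Suc j)
    then have j: "j < k" by simp
    have "linear (\<lambda>h. L (replicate j (c *\<^sub>R x) @ h # replicate (k - Suc j) x))"
      using j by (intro multilinear_form_linear[OF L]) auto
    from linear_scale[OF this, of c x] show ?case
      using Suc unfolding replicate_Suc_split[OF j] by simp
  qed simp
  from this[of k] show ?thesis by simp
qed

lemma abs_le_mnorm:
  assumes L: "multilinear_form k L" and hs: "length hs = k" "\<forall>h\<in>set hs. norm h \<le> 1"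
  shows "\<bar>L hs\<bar> \<le> mnorm k L"
proof -
  obtain C where C: "\<And>hs. length hs = k \<Longrightarrow> \<bar>L hs\<bar> \<le> C * prod_list (map norm hs)"
    using L unfolding multilinear_form_def by blast
  have "\<bar>L gs\<bar> \<le> \<bar>C\<bar>" if gs: "length gs = k" "\<forall>h\<in>set gs. norm h \<le> 1" for gs
  proof -
    have "0 \<le> prod_list (map norm gs) \<and> prod_list (map norm gs) \<le> 1"
      using gs(2) by (induction gs) (auto intro: mult_le_one)
    then have "C * prod_list (map norm gs) \<le> \<bar>C\<bar> * 1" by (intro mult_mono) auto
    then show ?thesis using C[OF gs(1)] by simp
  qed
  then show ?thesis
    unfolding mnorm_def using hs by (intro cSUP_upper bdd_aboveI[of _ "\<bar>C\<bar>"]) auto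
qed

lemma abs_multilinear_le_mnorm:
  assumes L: "multilinear_form k L"
  shows "\<bar>L (replicate k x)\<bar> \<le> mnorm k L * norm x ^ k"
proof -
  \<comment> \<open>For \<open>x = 0\<close> division by zero gives \<open>e = 0\<close>, and
    \<open>x = norm x *\<^sub>R e\<close> remains true.\<close>
  define e where "e = x /\<^sub>R norm x"
  have x: "x = norm x *\<^sub>R e" and e: "norm e \<le> 1" by (cases "x = 0"; simp add: e_def)+
  have "\<bar>L (replicate k x)\<bar> = norm x ^ k * \<bar>L (replicate k e)\<bar>"
    by (subst x, subst multilinear_form_homogeneous[OF L]) (simp add: abs_mult)
  also have "\<dots> \<le> norm x ^ k * mnorm k L"
    using e by (intro mult_left_mono abs_le_mnorm[OF L]) auto
  finally show ?thesis by (simp add: mult.commute)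
qed

text \<open>Because \<open>\<omega> k ^ k \<ge> 1\<close>, one constant \<open>B\<close> bounds the
  norms of all derivatives at 0, and the Taylor series is dominated by \<open>B\<close> times the
  exponential series. Measurability holds since \<open>f\<close> is a pointwise limit of sums of
  continuous homogeneous polynomials.\<close>

lemma E_omega_growth:
  assumes f: "f \<in> E_omega \<omega>" and \<omega>: "\<And>k. \<omega> k > 1"
  shows "\<exists>B. \<forall>x. \<bar>f x\<bar> \<le> B * exp (norm x)"
    and "(f :: 'a::{real_normed_vector, second_countable_topology} \<Rightarrow> real) \<in> borel_measurable borel"
proof -
  from f obtain D where D: "higher_frechet_derivs_at f D 0"
    and sums: "\<And>x. (\<lambda>k. D k 0 (replicate k x) / fact k) sums f x"
    and bdd: "bdd_above (range (\<lambda>k. mnorm k (D k 0) * \<omega> k ^ k))"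
    unfolding E_omega_def by blast
  have L: "multilinear_form k (D k 0)" for k
    using D unfolding higher_frechet_derivs_at_def by (metis centre_in_ball)
  obtain B where B: "\<And>k. mnorm k (D k 0) * \<omega> k ^ k \<le> B"
    using bdd unfolding bdd_above_def by blast
  have mnorm_le: "mnorm k (D k 0) \<le> B" for k
  proof -
    have "0 \<le> mnorm k (D k 0)"
      by (rule order_trans[OF abs_ge_zero abs_le_mnorm[OF L, of "replicate k 0"]]) auto
    then have "mnorm k (D k 0) * 1 \<le> mnorm k (D k 0) * \<omega> k ^ k"
      using \<omega>[of k] by (intro mult_left_mono one_le_power) auto
    then show ?thesis using B[of k] by simp
  qed
  have "\<bar>f x\<bar> \<le> B * exp (norm x)" for x
  proof -
    have e: "(\<lambda>k. B * (norm x ^ k /\<^sub>R fact k)) sums (B * exp (norm x))"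
      by (intro sums_mult exp_converges)
    have "norm (\<Sum>k. D k 0 (replicate k x) / fact k) \<le> (\<Sum>k. B * (norm x ^ k /\<^sub>R fact k))"
    proof (rule norm_suminf_le)
      fix k
      have "\<bar>D k 0 (replicate k x)\<bar> \<le> B * norm x ^ k"
        by (rule order_trans[OF abs_multilinear_le_mnorm[OF L]]) (simp add: mult_right_mono mnorm_le)
      then show "norm (D k 0 (replicate k x) / fact k) \<le> B * (norm x ^ k /\<^sub>R fact k)"
        by (simp add: divide_simps)
    qed (use e in \<open>simp add: sums_iff\<close>)
    then show ?thesis using sums[of x] e by (simp add: sums_iff)
  qed
  then show "\<exists>B. \<forall>x. \<bar>f x\<bar> \<le> B * exp (norm x)" by blast
  have "(\<lambda>x. D k 0 (replicate k x) / fact k) \<in> borel_measurable borel" for k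
    by (intro borel_measurable_divide borel_measurable_continuous_onI multilinear_form_continuous[OF L] borel_measurable_const)
  then have "(\<lambda>x. \<Sum>k. D k 0 (replicate k x) / fact k) \<in> borel_measurable borel"
    by (rule borel_measurable_suminf)
  moreover have "(\<lambda>x. \<Sum>k. D k 0 (replicate k x) / fact k) = f"
    using sums by (auto simp: sums_iff)
  ultimately show "f \<in> borel_measurable borel" by simp
qed

text \<open>Squaring the growth bound produces \<open>exp (2 * norm y)\<close>, exactly the moment
  that the choice of \<open>p\<close> secures.\<close>

lemma (in orbit_series) E_omega_square_integrable:
  assumes f: "f \<in> E_omega \<omega>" and \<omega>: "\<And>k. \<omega> k > 1"
  shows "f \<in> borel_measurable law" "integrable law (\<lambda>y. (f y)\<^sup>2)"
proof -
  have meas [measurable]: "f \<in> borel_measurable borel" by (rule E_omega_growth(2)[OF f \<omega>])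
  then show "f \<in> borel_measurable law" by (simp add: law_def)
  obtain B where B: "\<And>x. \<bar>f x\<bar> \<le> B * exp (norm x)"
    using E_omega_growth(1)[OF f \<omega>] by blast
  have "integrable W (\<lambda>w. (f (Y w))\<^sup>2)"
  proof (rule Bochner_Integration.integrable_bound)
    show "integrable W (\<lambda>w. B\<^sup>2 * exp (2 * norm (Y w)))"
      by (intro integrable_mult_right integrable_exp_norm_Y)
    show "(\<lambda>w. (f (Y w))\<^sup>2) \<in> borel_measurable W"
      by (intro borel_measurable_power measurable_compose[OF measurable_Y meas])
    have "\<bar>f y\<bar>\<^sup>2 \<le> (B * exp (norm y))\<^sup>2" for y by (intro power_mono B) simp
    then have "(f y)\<^sup>2 \<le> B\<^sup>2 * exp (2 * norm y)" for y
      by (simp add: power_mult_distrib exp_double)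
    then show "AE w in W. norm ((f (Y w))\<^sup>2) \<le> norm (B\<^sup>2 * exp (2 * norm (Y w)))"
      by (intro always_eventually allI) simp
  qed
  then show "integrable law (\<lambda>y. (f y)\<^sup>2)"
    unfolding law_def by (subst integrable_distr_eq) simp_all
qed

section \<open>Construction of the measure\<close>

lemma rational_approximation:
  fixes r :: real
  assumes "e > 0"
  obtains q :: rat where "\<bar>r - of_rat q\<bar> < e"
proof -
  obtain q where "r - e < of_rat q" "of_rat q < r + e"
    using of_rat_dense[of "r - e" "r + e"] assms by auto
  then show thesis by (intro that[of q]) linarith
qed

text \<open>Random signs replace real coefficients, so every rational multiple \<open>q x\<^sub>n\<close> enters the family as
  a vector of its own.\<close>

definition rational_multiple :: "(nat \<Rightarrow> int \<Rightarrow> 'a::real_vector) \<Rightarrow> nat \<Rightarrow> int \<Rightarrow> 'a" where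
  "rational_multiple v m k =
    real_of_rat (from_nat (fst (prod_decode m))) *\<^sub>R v (Suc (snd (prod_decode m))) k"

text \<open>A sum over a set of indices gives every vector the coefficient 1, so the coefficients
  move into the index: \<open>j b\<close> encodes a rational approximation to the coefficient of
  \<open>b\<close> together with a place where \<open>b\<close> occurs in the orbits.\<close>

lemma rational_multiple_dense:
  fixes v :: "nat \<Rightarrow> int \<Rightarrow> 'a::real_normed_vector"
  assumes dense: "closure (span {v n k | n k. n \<ge> 1}) = UNIV" and e: "e > 0"
  shows "\<exists>J. finite J \<and> norm (y - (\<Sum>(m, k)\<in>J. rational_multiple v m k)) < e"
proof -
  have "y \<in> closure (span {v n k | n k. n \<ge> 1})" using dense by simp
  then obtain z where z: "z \<in> span {v n k | n k. n \<ge> 1}" "dist z y < e / 2"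
    using e unfolding closure_approachable by (auto dest: spec[of _ "e / 2"])
  then obtain t r where t: "finite t" "t \<subseteq> {v n k | n k. n \<ge> 1}" "z = (\<Sum>b\<in>t. r b *\<^sub>R b)"
    unfolding span_explicit by blast
  have "\<forall>b\<in>t. \<exists>i. fst i \<ge> 1 \<and> v (fst i) (snd i) = b"
  proof
    fix b assume "b \<in> t"
    then obtain n k where "n \<ge> 1" "b = v n k" using t(2) by blast
    then show "\<exists>i. fst i \<ge> 1 \<and> v (fst i) (snd i) = b" by (intro exI[of _ "(n, k)"]) simp
  qed
  then obtain i where i: "\<And>b. b \<in> t \<Longrightarrow> fst (i b) \<ge> 1" "\<And>b. b \<in> t \<Longrightarrow> v (fst (i b)) (snd (i b)) = b"
    by metis
  \<comment> \<open>Rounding all coefficients then moves the combination by at most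
    \<open>e / 2\<close>; the \<open>+ 1\<close> excludes a zero denominator.\<close>
  define \<delta> where "\<delta> = e / (2 * ((\<Sum>b\<in>t. norm b) + 1))"
  have pos: "(\<Sum>b\<in>t. norm b) + 1 > 0" by (simp add: add_nonneg_pos sum_nonneg)
  then have \<delta>: "\<delta> > 0" using e by (simp add: \<delta>_def)
  have "\<forall>b. \<exists>q. \<bar>r b - real_of_rat q\<bar> < \<delta>"
  proof
    show "\<exists>q. \<bar>r b - real_of_rat q\<bar> < \<delta>" for b
      by (rule rational_approximation[OF \<delta>, of "r b"]) blast
  qed
  then obtain q where q: "\<And>b. \<bar>r b - real_of_rat (q b)\<bar> < \<delta>" by metis
  \<comment> \<open>The given vectors are numbered from 1 and the encoding from 0, hence
    \<open>fst (i b) - 1\<close>.\<close>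
  define j where "j b = (prod_encode (to_nat (q b), fst (i b) - 1), snd (i b))" for b
  have j: "rational_multiple v (fst (j b)) (snd (j b)) = real_of_rat (q b) *\<^sub>R b" if "b \<in> t" for b
    using i[OF that] by (simp add: rational_multiple_def j_def)
  \<comment> \<open>No two vectors of \<open>t\<close> may share an index, or a summand would be
    lost; the place \<open>i b\<close> alone already determines \<open>b\<close>.\<close>
  have "inj_on j t"
  proof (rule inj_onI)
    fix b c assume bc: "b \<in> t" "c \<in> t" "j b = j c"
    then have "fst (i b) - 1 = fst (i c) - 1" "snd (i b) = snd (i c)"
      using bc(3) by (simp_all add: j_def)
    with i(1)[OF bc(1)] i(1)[OF bc(2)] have "fst (i b) = fst (i c)" "snd (i b) = snd (i c)"
      by linarith+
    then have "i b = i c" by (rule prod_eqI)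
    then have "v (fst (i b)) (snd (i b)) = v (fst (i c)) (snd (i c))" by simp
    then show "b = c" unfolding i(2)[OF bc(1)] i(2)[OF bc(2)] .
  qed
  then have "(\<Sum>(m, k)\<in>j ` t. rational_multiple v m k) = (\<Sum>b\<in>t. real_of_rat (q b) *\<^sub>R b)"
    by (simp add: sum.reindex split_beta j cong: sum.cong)
  then have "norm (z - (\<Sum>(m, k)\<in>j ` t. rational_multiple v m k)) = norm (\<Sum>b\<in>t. (r b - real_of_rat (q b)) *\<^sub>R b)"
    by (simp add: t(3) sum_subtractf scaleR_left_diff_distrib)
  also have "\<dots> \<le> (\<Sum>b\<in>t. \<delta> * norm b)"
    using q by (intro order_trans[OF norm_sum] sum_mono) (simp add: mult_right_mono less_imp_le)
  also have "\<dots> \<le> \<delta> * ((\<Sum>b\<in>t. norm b) + 1)"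
    using \<delta> by (simp add: sum_distrib_left algebra_simps)
  also have "\<dots> = e / 2"
  proof -
    have "e / (2 * s) * s = e / 2" if "s > 0" for s using that by simp
    from this[OF pos] show ?thesis unfolding \<delta>_def .
  qed
  finally have "norm (z - (\<Sum>(m, k)\<in>j ` t. rational_multiple v m k)) \<le> e / 2" .
  then have "norm (y - (\<Sum>(m, k)\<in>j ` t. rational_multiple v m k)) < e"
    using z(2) norm_triangle_ineq[of "y - z" "z - (\<Sum>(m, k)\<in>j ` t. rational_multiple v m k)"]
    by (simp add: dist_norm norm_minus_commute)
  then show ?thesis using t(1) by blast
qed

lemma summable_on_two_sided:
  fixes v :: "int \<Rightarrow> 'a::banach"
  assumes pos: "(\<lambda>n. v (int n)) summable_on UNIV" and neg: "(\<lambda>n. v (- int n)) summable_on {1..}"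
  shows "v summable_on UNIV"
proof -
  have "v summable_on {0..}"
  proof -
    have "bij_betw int UNIV {0..}"
      by (rule bij_betw_byWitness[where f'=nat]) auto
    then show ?thesis
      using pos by (subst (asm) summable_on_reindex_bij_betw)
  qed
  moreover have "bij_betw (\<lambda>n. - int n) {1..} {..<0}"
    by (rule bij_betw_byWitness[where f'="\<lambda>k. nat (- k)"]) auto
  then have "v summable_on {..<0}"
    using neg summable_on_reindex_bij_betw[of "\<lambda>n. - int n" "{1..}" "{..<0}" v] by simp
  ultimately have "v summable_on ({0..} \<union> {..<0})"
    by (intro summable_on_Un_disjoint) auto
  moreover have "{0..} \<union> {..<0 :: int} = UNIV" by auto
  ultimately show ?thesis by simp
qed

theorem theorem4p2:
  fixes T :: "'a::{banach, second_countable_topology} \<Rightarrow> 'a"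
    and \<alpha> :: real and \<omega> :: "nat \<Rightarrow> real"
  assumes T_lin: "bounded_linear T"
    and alpha: "\<alpha> > 1"
    and omega_gt: "\<And>k. \<omega> k > 1"
    and omega_lim: "filterlim \<omega> at_top sequentially"
    and hyp: "\<And>\<omega>0 :: real \<Rightarrow> real.
       (\<forall>t\<ge>1. \<omega>0 t > 1) \<Longrightarrow> filterlim \<omega>0 at_top at_top \<Longrightarrow>
       \<exists>(x :: nat \<Rightarrow> 'a) (S :: nat \<Rightarrow> 'a \<Rightarrow> 'a).
         (\<forall>y\<in>x ` {1..}. (\<lambda>n. (T ^^ n) y) summable_on UNIV) \<and>
         (\<forall>y\<in>x ` {1..}. (\<lambda>n. S n y) summable_on UNIV) \<and>
         (\<forall>y\<in>x ` {1..}. \<forall>n. (T ^^ n) (S n y) = y \<and>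
              (\<forall>m<n. (T ^^ m) (S n y) = S (n - m) y)) \<and>
         (\<forall>nk :: int \<Rightarrow> nat. (\<forall>k. nk k \<ge> 1) \<longrightarrow>
              summable (\<lambda>k. (T ^^ k) (x (nk (int k)))) \<longrightarrow>
              summable (\<lambda>j. S (Suc j) (x (nk (- int (Suc j))))) \<longrightarrow>
              (\<lambda>k. \<omega>0 (real (nk k)) * (1 + \<bar>real_of_int k\<bar>) powr (- \<alpha>)) summable_on UNIV \<longrightarrow>
              norm (\<Sum>k. (T ^^ k) (x (nk (int k)))) + norm (\<Sum>j. S (Suc j) (x (nk (- int (Suc j)))))
                \<le> (\<Sum>\<^sub>\<infinity>k. \<omega>0 (real (nk k)) * (1 + \<bar>real_of_int k\<bar>) powr (- \<alpha>))) \<and>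
         closure (span ({(T ^^ k) (x n) | k n. n \<ge> 1} \<union> {S k (x n) | k n. n \<ge> 1})) = UNIV"
  shows "\<exists>\<mu> :: 'a measure.
     sets \<mu> = sets borel \<and> prob_space \<mu> \<and>
     T \<in> measurable \<mu> \<mu> \<and> (\<forall>A\<in>sets \<mu>. emeasure \<mu> (T -` A \<inter> space \<mu>) = emeasure \<mu> A) \<and>
     (\<forall>U. open U \<and> U \<noteq> {} \<longrightarrow> emeasure \<mu> U > 0) \<and>
     (\<forall>A\<in>sets borel. \<forall>B\<in>sets borel.
        (\<lambda>n. measure \<mu> (A \<inter> (T ^^ n) -` B)) \<longlonglongrightarrow> measure \<mu> A * measure \<mu> B) \<and>
     (\<forall>f\<in>E_omega \<omega>. f \<in> borel_measurable \<mu> \<and> integrable \<mu> (\<lambda>y. (f y)\<^sup>2)) \<and>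
     (\<forall>xs :: 'a \<Rightarrow> real. bounded_linear xs \<longrightarrow>
        (\<exists>m \<sigma>. \<sigma> \<ge> 0 \<and>
           weak_conv_m
             (\<lambda>n. distr \<mu> borel (\<lambda>y. (\<Sum>j<n. xs ((T ^^ j) y)) / sqrt (real n)))
             (if \<sigma> = 0 then return borel m else density lborel (normal_density m \<sigma>))))"
proof -
  have lim: "filterlim (\<lambda>t :: real. 1 + t) at_top at_top"
    by (rule filterlim_tendsto_add_at_top[OF tendsto_const filterlim_ident])
  have gt: "\<forall>t\<ge>1. 1 + t > (1 :: real)" by auto
  note E = hyp[OF gt lim]
  obtain x :: "nat \<Rightarrow> 'a" and S where forward: "\<forall>y\<in>x ` {1..}. (\<lambda>n. (T ^^ n) y) summable_on UNIV"
    and backward: "\<forall>y\<in>x ` {1..}. (\<lambda>n. S n y) summable_on UNIV"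
    and inverse: "\<forall>y\<in>x ` {1..}. \<forall>n. (T ^^ n) (S n y) = y \<and> (\<forall>m<n. (T ^^ m) (S n y) = S (n - m) y)"
    and dense: "closure (span ({(T ^^ k) (x n) | k n. n \<ge> 1} \<union> {S k (x n) | k n. n \<ge> 1})) = UNIV"
    using E by (elim exE conjE) (rule that)
  define v where "v n k = (if k \<ge> 0 then (T ^^ nat k) (x n) else S (nat (- k)) (x n))" for n k
  define u where "u = rational_multiple v"
  interpret T: bounded_linear T by (rule T_lin)
  have S0: "S 0 (x n) = x n" and S1: "T (S (Suc 0) (x n)) = x n"
    and S_Suc: "T (S (Suc (Suc j)) (x n)) = S (Suc j) (x n)" if "n \<ge> 1" for n j
  proof -
    have xn: "x n \<in> x ` {1..}" using that by auto
    show "S 0 (x n) = x n" using inverse[rule_format, OF xn, of 0] by simp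
    show "T (S (Suc 0) (x n)) = x n" using inverse[rule_format, OF xn, of "Suc 0"] by simp
    show "T (S (Suc (Suc j)) (x n)) = S (Suc j) (x n)"
      using inverse[rule_format, OF xn, of "Suc (Suc j)", THEN conjunct2, rule_format, of "Suc 0"] by simp
  qed
  have T_v: "T (v n k) = v n (k + 1)" if n: "n \<ge> 1" for n k
  proof -
    \<comment> \<open>The step from -1 to 0 leaves the backward branch and uses that
      \<open>T\<close> inverts \<open>S 1\<close>. The relation lowering the index of
      \<open>S\<close> is the hypothesis with \<open>m = 1 < n\<close>, so it serves only positions
      up to -2.\<close>
    consider "k \<ge> 0" | "k = -1" | j where "k = - int (Suc (Suc j))"
    proof (cases "k \<ge> -1")
      case False
      then have "k = - int (Suc (Suc (nat (- k - 2))))" by simp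
      then show thesis using that(3) by blast
    next
      case True
      then have "k \<ge> 0 \<or> k = -1" by linarith
      then show thesis using that(1,2) by blast
    qed
    then show ?thesis
    proof cases
      case 1
      then show ?thesis by (simp add: v_def nat_add_distrib)
    next
      case 2
      then show ?thesis using S1[OF n] by (simp add: v_def)
    next
      case 3
      then have "nat (- k) = Suc (Suc j)" "nat (- (k + 1)) = Suc j" "k < 0" "k + 1 < 0" by auto
      then show ?thesis using S_Suc[OF n, of j] by (simp add: v_def)
    qed
  qed
  have v_summable: "v n summable_on UNIV" if "n \<ge> 1" for n
  proof (rule summable_on_two_sided)
    have xn: "x n \<in> x ` {1..}" using that by auto
    show "(\<lambda>j. v n (int j)) summable_on UNIV" using forward[rule_format, OF xn] by (simp add: v_def)
    have "(\<lambda>j. S j (x n)) summable_on {1..}"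
      by (rule summable_on_subset_banach[OF backward[rule_format, OF xn]]) simp
    then show "(\<lambda>j. v n (- int j)) summable_on {1..}"
      by (rule summable_on_cong[THEN iffD1, rotated]) (simp add: v_def)
  qed
  have T_u: "T (u m k) = u m (k + 1)" for m k
    by (simp add: u_def rational_multiple_def T.scaleR T_v)
  have u_summable: "u m summable_on UNIV" for m
    unfolding u_def rational_multiple_def[abs_def]
    by (rule summable_on_scaleR_right[OF v_summable]) simp
  have "\<forall>m. \<exists>F. finite F \<and> (\<forall>A. A \<inter> F = {} \<longrightarrow> norm (infsum (u m) A) \<le> (1/2) ^ m)"
  proof
    have "(1/2 :: real) ^ m > 0" for m by simp
    then show "\<exists>F. finite F \<and> (\<forall>A. A \<inter> F = {} \<longrightarrow> norm (infsum (u m) A) \<le> (1/2) ^ m)" for m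
      using summable_on_tail[OF u_summable, of "(1/2) ^ m" m] by metis
  qed
  then obtain F where F: "\<And>m. finite (F m)" "\<And>m A. A \<inter> F m = {} \<Longrightarrow> norm (infsum (u m) A) \<le> (1/2) ^ m"
    by metis
  interpret orbit_series u F T
    by unfold_locales (use u_summable F T_lin T_u in auto)
  have span_v: "{(T ^^ k) (x n) | k n. n \<ge> 1} \<union> {S k (x n) | k n. n \<ge> 1} \<subseteq> {v n k | n k. n \<ge> 1}"
  proof (intro Un_least subsetI)
    fix y assume "y \<in> {(T ^^ k) (x n) | k n. n \<ge> 1}"
    then obtain k n where "n \<ge> 1" "y = v n (int k)" by (auto simp: v_def)
    then show "y \<in> {v n k | n k. n \<ge> 1}" by blast
  next
    fix y assume "y \<in> {S k (x n) | k n. n \<ge> 1}"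
    then obtain k n where n: "n \<ge> 1" and y: "y = S k (x n)" by blast
    \<comment> \<open>At \<open>k = 0\<close> the value of \<open>v\<close> comes from the forward
      branch, so \<open>S 0\<close> has to fix the given vectors.\<close>
    have "y = v n (- int k)" using S0[OF n] y by (cases "k = 0") (simp_all add: v_def)
    then show "y \<in> {v n k | n k. n \<ge> 1}" using n by blast
  qed
  have dense_v: "closure (span {v n k | n k. n \<ge> 1}) = UNIV"
    using closure_mono[OF span_mono[OF span_v]] unfolding dense by (intro equalityI subset_UNIV)
  have full: "emeasure law U > 0" if U: "open U" "U \<noteq> {}" for U
  proof -
    interpret law: prob_space law by (rule prob_space_law)
    obtain y \<epsilon> where y: "\<epsilon> > 0" "ball y \<epsilon> \<subseteq> U"
      using U unfolding open_contains_ball by blast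
    obtain J where J: "finite J" "norm (y - (\<Sum>(m, k)\<in>J. u m k)) < \<epsilon> / 2"
      using rational_multiple_dense[OF dense_v, of "\<epsilon> / 2" y] y(1) unfolding u_def by auto
    then have "measure law (ball y \<epsilon>) > 0"
      using prob_ball_pos[OF J y(1)] by (simp add: measure_law)
    also have "measure law (ball y \<epsilon>) \<le> measure law U"
      using y(2) U by (intro law.finite_measure_mono) (auto simp: sets_law)
    finally show ?thesis by (simp add: law.emeasure_eq_measure)
  qed
  have clt: "\<exists>m \<sigma>. \<sigma> \<ge> 0 \<and> weak_conv_m
      (\<lambda>n. distr law borel (\<lambda>y. (\<Sum>j<n. xs ((T ^^ j) y)) / sqrt (real n)))
      (if \<sigma> = 0 then return borel m else density lborel (normal_density m \<sigma>))"
    if xs: "bounded_linear xs" for xs :: "'a \<Rightarrow> real"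
  proof -
    obtain K where K: "K > 0" "\<And>x. norm (xs x) \<le> norm x * K"
      using bounded_linear.pos_bounded[OF xs] by blast
    have "\<bar>xs x\<bar> \<le> K * norm x" for x using K(2)[of x] by (simp add: mult.commute)
    then interpret orbit_functional u F T xs K
      using xs K(1) by (intro orbit_functional.intro orbit_series_axioms orbit_functional_axioms.intro) auto
    show ?thesis
      \<comment> \<open>The limit is centred because the signs are symmetric.\<close>
      by (rule exI[of _ 0], rule exI, rule conjI[OF sigma_nonneg central_limit_theorem_law])
  qed
  have meas_T: "T \<in> measurable law law"
    using measurable_funpow[of 1] by (simp add: law_def)
  have invariant: "\<forall>A\<in>sets law. emeasure law (T -` A \<inter> space law) = emeasure law A"
    using law_invariant by (simp add: sets_law space_law)
  have mixing: "\<forall>A\<in>sets borel. \<forall>B\<in>sets borel.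
      (\<lambda>n. measure law (A \<inter> (T ^^ n) -` B)) \<longlonglongrightarrow> measure law A * measure law B"
    by (intro ballI law_strongly_mixing)
  have E_omega: "\<forall>f\<in>E_omega \<omega>. f \<in> borel_measurable law \<and> integrable law (\<lambda>y. (f y)\<^sup>2)"
    by (intro ballI conjI) (erule E_omega_square_integrable[OF _ omega_gt])+
  show ?thesis
    by (rule exI[of _ law], intro conjI sets_law prob_space_law meas_T invariant mixing E_omega)
      (intro allI impI, erule conjE, rule full, assumption+, intro allI impI, rule clt)
qed

end
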